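(* There exists a testing algorithm for monotonicity of distributions over $[n]$ in the ${\sf INTCOND}$ model whose query complexity is $\tilde{O}(\log^5 n/\varepsilon^4)$. That is, there is a randomized algorithm which, given $n$, $\varepsilon\in(0,1]$ and ${\sf INTCOND}$ oracle access to an unknown distribution $D$ over $[n]$, makes $\tilde{O}(\log^5 n/\varepsilon^4)$ oracle calls and outputs ACCEPT with probability at least $2/3$ if $D$ is monotone, and REJECT with probability at least $2/3$ if $d_{TV}(D,\mathcal{M})\ge\varepsilon$.
   Context: A distribution $D$ over $[n]=\{1,\dots,n\}$ is monotone if $D(1)\ge\dots\ge D(n)$; $\mathcal{M}$ is the class of monotone distributions over $[n]$. $d_{TV}(D_1,D_2)=\frac12\sum_x|D_1(x)-D_2(x)|$, $d_{TV}(D,\mathcal{M})=\inf_{D'\in\mathcal{M}}d_{TV}(D,D')$. An ${\sf INTCOND}$ oracle for $D$ takes as input an interval $S=\{a,a+1,\dots,b\}\subseteq[n]$ ($a\le b$) with $D(S)>0$ and returns $i\in S$ with probability $D(i)/D(S)$, independently of previous calls. $\tilde{O}(\cdot)$ hides polylogarithmic factors in its argument. *)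

theory Defs
  imports "HOL-Probability.Probability"
begin

text \<open>A distribution over \<open>[n] = {1..n}\<close> is a \<open>nat pmf\<close> supported in \<open>{1..n}\<close>.\<close>

definition distributions :: "nat \<Rightarrow> nat pmf set" where
  "distributions n = {D. set_pmf D \<subseteq> {1..n}}"

definition monotone_distributions :: "nat \<Rightarrow> nat pmf set" where
  "monotone_distributions n =
     {D \<in> distributions n. \<forall>i j. 1 \<le> i \<longrightarrow> i \<le> j \<longrightarrow> j \<le> n \<longrightarrow> pmf D j \<le> pmf D i}"

definition tv_dist :: "nat \<Rightarrow> nat pmf \<Rightarrow> nat pmf \<Rightarrow> real" where
  "tv_dist n D1 D2 = 1 / 2 * (\<Sum>x = 1..n. \<bar>pmf D1 x - pmf D2 x\<bar>)"

definition tv_dist_to :: "nat \<Rightarrow> nat pmf \<Rightarrow> nat pmf set \<Rightarrow> real" where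
  "tv_dist_to n D C = (INF D' \<in> C. tv_dist n D D')"

text \<open>
  The answer of the oracle for \<open>D\<close> on the interval \<open>{a..b}\<close>. It is meaningful only if \<open>{a..b}\<close>
  has positive mass under \<open>D\<close>; algorithms are required below never to issue any other query,
  so the unspecified value of \<^const>\<open>cond_pmf\<close> outside this domain plays no role.
\<close>

definition intcond :: "nat pmf \<Rightarrow> nat \<Rightarrow> nat \<Rightarrow> nat pmf" where
  "intcond D a b = cond_pmf D {a..b}"

lemma pmf_intcond:
  assumes "measure_pmf.prob D {a..b} > 0"
  shows "pmf (intcond D a b) i =
           (if i \<in> {a..b} then pmf D i / measure_pmf.prob D {a..b} else 0)"
proof -
  have "set_pmf D \<inter> {a..b} \<noteq> {}"
    using assms by (simp add: measure_pmf_zero_iff[symmetric])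
  then show ?thesis
    by (simp add: intcond_def pmf_cond)
qed

text \<open>The domain of the oracle for \<open>D\<close>.\<close>

definition admissible_query :: "nat \<Rightarrow> nat pmf \<Rightarrow> nat \<times> nat \<Rightarrow> bool" where
  "admissible_query n D = (\<lambda>(a, b). 1 \<le> a \<and> a \<le> b \<and> b \<le> n \<and> measure_pmf.prob D {a..b} > 0)"

datatype verdict = ACCEPT | REJECT

text \<open>
  Adaptive randomized algorithms with oracle access, as decision trees: \<open>Random p f\<close> draws \<open>r\<close>
  from \<open>p\<close> using internal randomness only and continues as \<open>f r\<close>; \<open>Query a b f\<close> calls the oracle
  on \<open>{a..b}\<close> and continues as \<open>f i\<close>, where \<open>i\<close> is the answer. The unknown distribution is
  accessible through \<open>Query\<close> nodes only.
\<close>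

datatype intcond_algorithm =
    Output verdict
  | Random "nat pmf" "nat \<Rightarrow> intcond_algorithm"
  | Query nat nat "nat \<Rightarrow> intcond_algorithm"

text \<open>
  Joint distribution of the verdict and of the list of queries made in an execution. Each
  \<open>Query\<close> node draws a fresh sample, so answers are independent of previous calls.
\<close>

primrec run :: "nat pmf \<Rightarrow> intcond_algorithm \<Rightarrow> (verdict \<times> (nat \<times> nat) list) pmf" where
  "run D (Output v) = return_pmf (v, [])"
| "run D (Random p f) = bind_pmf p (\<lambda>r. run D (f r))"
| "run D (Query a b f) =
     bind_pmf (intcond D a b) (\<lambda>i. map_pmf (\<lambda>(v, qs). (v, (a, b) # qs)) (run D (f i)))"

definition prob_outputs :: "nat pmf \<Rightarrow> intcond_algorithm \<Rightarrow> verdict \<Rightarrow> real" where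
  "prob_outputs D A v = measure_pmf.prob (run D A) {r. fst r = v}"

definition queries_admissible :: "nat \<Rightarrow> intcond_algorithm \<Rightarrow> bool" where
  "queries_admissible n A \<longleftrightarrow>
     (\<forall>D \<in> distributions n. \<forall>(v, qs) \<in> set_pmf (run D A). \<forall>S \<in> set qs. admissible_query n D S)"

definition makes_at_most :: "nat \<Rightarrow> intcond_algorithm \<Rightarrow> nat \<Rightarrow> bool" where
  "makes_at_most n A q \<longleftrightarrow>
     (\<forall>D \<in> distributions n. \<forall>(v, qs) \<in> set_pmf (run D A). length qs \<le> q)"

definition monotonicity_tester :: "nat \<Rightarrow> real \<Rightarrow> intcond_algorithm \<Rightarrow> bool" where
  "monotonicity_tester n \<epsilon> A \<longleftrightarrow>
     queries_admissible n A \<and>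
     (\<forall>D \<in> distributions n.
        (D \<in> monotone_distributions n \<longrightarrow> prob_outputs D A ACCEPT \<ge> 2 / 3) \<and>
        (tv_dist_to n D (monotone_distributions n) \<ge> \<epsilon> \<longrightarrow> prob_outputs D A REJECT \<ge> 2 / 3))"

text \<open>
  \<open>f = O(g \<cdot> polylog g)\<close>, uniformly on \<open>X\<close>. The argument of the logarithm is shifted by 2
  because \<open>g\<close> may take values near or below 1, where \<open>log g\<close> vanishes or is negative.
\<close>

definition soft_O_on :: "'a set \<Rightarrow> ('a \<Rightarrow> real) \<Rightarrow> ('a \<Rightarrow> real) \<Rightarrow> bool" where
  "soft_O_on X f g \<longleftrightarrow>
     (\<exists>(C::real) (k::nat). \<forall>x \<in> X. f x \<le> C * g x * log 2 (2 + g x) ^ k)"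

end

theory Submission
  imports Defs
begin

text \<open>
  Learn, then verify. From samples of \<open>D\<close>, fix a monotone \<open>H\<close> that is close to \<open>D\<close> in case \<open>D\<close> is
  monotone: it is enough that \<open>H\<close> fits the empirical weights of \<open>O(log n / \<eta>)\<close> intervals growing
  by a factor \<open>1 + \<eta>\<close> (Birge's partition), since two monotone distributions with the same weights
  on these intervals are \<open>O(\<eta>)\<close>-close.

  To compare \<open>D\<close> with \<open>H\<close>, descend the dyadic tree over \<open>[n]\<close>, of depth \<open>L = O(log n)\<close>: replacing
  the splitting ratios of \<open>H\<close> by those of \<open>D\<close> one level at a time shows that \<open>d\<^sub>T\<^sub>V(D, H)\<close> is at most
  the sum over the levels of the expected difference between the splitting ratios of \<open>D\<close> and \<open>H\<close>
  at the cell of a random point of \<open>D\<close>; conversely each of these expectations is at most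
  \<open>4 d\<^sub>T\<^sub>V(D, H)\<close>. So it suffices to learn \<open>H\<close> to accuracy \<open>O(\<beta>)\<close> with \<open>\<beta> = \<epsilon> / L\<close> and to tell an average
  of at least \<open>\<beta>\<close> from one below \<open>\<beta> / 25\<close>, using \<open>O(1 / \<beta>)\<close> cells at random levels and estimating each
  ratio from \<open>O(1 / \<beta>\<^sup>2)\<close> conditional samples. Second moments suffice throughout, and the total is
  \<open>O(log\<^sup>4 n / \<epsilon>\<^sup>3)\<close> queries.
\<close>

section \<open>Moments of sums of independent samples\<close>

lemma expectation_bind_pmf_finite:
  fixes h :: "'b \<Rightarrow> real"
  assumes "finite (set_pmf p)" "\<And>x. x \<in> set_pmf p \<Longrightarrow> finite (set_pmf (f x))"
  shows "measure_pmf.expectation (bind_pmf p f) h =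
           measure_pmf.expectation p (\<lambda>x. measure_pmf.expectation (f x) h)"
proof -
  have "measure_pmf.expectation (bind_pmf p f) h =
      (\<Sum>a\<in>set_pmf p. pmf p a *\<^sub>R measure_pmf.expectation (f a) h)"
    by (rule pmf_expectation_bind) (use assms in auto)
  also have "\<dots> = measure_pmf.expectation p (\<lambda>x. measure_pmf.expectation (f x) h)"
    by (rule integral_measure_pmf[symmetric]) (use assms in auto)
  finally show ?thesis .
qed

lemma finite_set_replicate_pmf:
  assumes "finite (set_pmf p)"
  shows "finite (set_pmf (replicate_pmf n p))"
  using finite_lists_length_eq[OF assms, of n]
  by (simp add: set_replicate_pmf lists_eq_set conj_commute)

lemma expectation_mono_finite:
  fixes f g :: "'a \<Rightarrow> real"
  assumes "finite (set_pmf p)" "\<And>x. x \<in> set_pmf p \<Longrightarrow> f x \<le> g x"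
  shows "measure_pmf.expectation p f \<le> measure_pmf.expectation p g"
  using assms by (intro integral_mono_AE integrable_measure_pmf_finite) (auto simp: AE_measure_pmf_iff)

lemma expectation_replicate_Suc:
  fixes h :: "'a list \<Rightarrow> real"
  assumes "finite (set_pmf p)"
  shows "measure_pmf.expectation (replicate_pmf (Suc n) p) h =
           measure_pmf.expectation p
             (\<lambda>x. measure_pmf.expectation (replicate_pmf n p) (\<lambda>xs. h (x # xs)))"
  using finite_set_replicate_pmf[OF assms, of n] assms
  by (simp add: expectation_bind_pmf_finite finite_set_replicate_pmf)

lemma expectation_sum_replicate:
  fixes f :: "'a \<Rightarrow> real"
  assumes "finite (set_pmf p)"
  shows "measure_pmf.expectation (replicate_pmf n p) (\<lambda>xs. \<Sum>x\<leftarrow>xs. f x) =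
           real n * measure_pmf.expectation p f"
proof (induction n)
  case (Suc n)
  note fin = integrable_measure_pmf_finite[OF assms]
    integrable_measure_pmf_finite[OF finite_set_replicate_pmf[OF assms]]
  show ?case
    unfolding expectation_replicate_Suc[OF assms]
    using Suc by (simp add: fin algebra_simps)
qed simp

text \<open>By induction on \<open>n\<close>: a fresh sample is independent of the others, so
  variances add, and each is at most E f^2 \<le> \<open>\<mu>\<close> because \<open>f\<close> takes
  values in [0, 1]. The factor \<open>\<mu>\<close> in the bound lets the bounds of disjoint blocks
  sum to \<open>n\<close>, and makes the squared relative deviation of the sum at most
  \<open>1 / (n * \<mu>)\<close>.\<close>

lemma second_moment_replicate:
  fixes f :: "'a \<Rightarrow> real"
  assumes fin: "finite (set_pmf p)" and f: "\<And>x. x \<in> set_pmf p \<Longrightarrow> 0 \<le> f x \<and> f x \<le> 1"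
  defines "\<mu> \<equiv> measure_pmf.expectation p f"
  shows "measure_pmf.expectation (replicate_pmf n p) (\<lambda>xs. ((\<Sum>x\<leftarrow>xs. f x) - real n * \<mu>)\<^sup>2)
           \<le> real n * \<mu>"
proof (induction n)
  case (Suc n)
  note int = integrable_measure_pmf_finite[OF fin]
    integrable_measure_pmf_finite[OF finite_set_replicate_pmf[OF fin]]
  define T where "T = (\<lambda>xs. (\<Sum>x\<leftarrow>xs. f x) - real n * \<mu>)"
  let ?E = "measure_pmf.expectation p" and ?R = "measure_pmf.expectation (replicate_pmf n p)"
  \<comment> \<open>The cross term of the expanded square carries the factor \<open>T\<close>, so it
    vanishes in expectation.\<close>
  have T0: "?R T = 0"
    unfolding T_def by (simp add: int expectation_sum_replicate[OF fin] \<mu>_def)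
  have "(\<lambda>xs. ((\<Sum>y\<leftarrow>x # xs. f y) - real (Suc n) * \<mu>)\<^sup>2) =
      (\<lambda>xs. (f x - \<mu>)\<^sup>2 + 2 * (f x - \<mu>) * T xs + (T xs)\<^sup>2)" for x
    by (rule ext) (simp add: T_def power2_eq_square algebra_simps)
  then have "measure_pmf.expectation (replicate_pmf (Suc n) p)
      (\<lambda>xs. ((\<Sum>x\<leftarrow>xs. f x) - real (Suc n) * \<mu>)\<^sup>2) = ?E (\<lambda>x. (f x - \<mu>)\<^sup>2 + ?R (\<lambda>xs. (T xs)\<^sup>2))"
    unfolding expectation_replicate_Suc[OF fin] by (simp add: int T0)
  also have "\<dots> = ?E (\<lambda>x. (f x)\<^sup>2 - 2 * \<mu> * f x + \<mu>\<^sup>2) + ?R (\<lambda>xs. (T xs)\<^sup>2)"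
    by (simp add: int power2_diff algebra_simps)
  also have "?E (\<lambda>x. (f x)\<^sup>2 - 2 * \<mu> * f x + \<mu>\<^sup>2) = ?E (\<lambda>x. (f x)\<^sup>2) - \<mu>\<^sup>2"
    by (simp add: int power2_eq_square flip: \<mu>_def)
  also have "?E (\<lambda>x. (f x)\<^sup>2) \<le> \<mu>"
    unfolding \<mu>_def using f by (intro expectation_mono_finite fin) (simp add: power2_eq_square mult_left_le)
  also have "?R (\<lambda>xs. (T xs)\<^sup>2) \<le> real n * \<mu>"
    using Suc unfolding T_def .
  finally show ?case
    by (simp add: algebra_simps) (smt (verit) zero_le_power2)
qed simp

lemma markov_finite:
  fixes f :: "'a \<Rightarrow> real"
  assumes "finite (set_pmf p)" "\<And>x. x \<in> set_pmf p \<Longrightarrow> 0 \<le> f x" "c > 0"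
  shows "measure_pmf.prob p {x. f x \<ge> c} \<le> measure_pmf.expectation p f / c"
  using integral_Markov_inequality_measure[of "measure_pmf p" f "{}" c] assms
  by (simp add: integrable_measure_pmf_finite AE_measure_pmf_iff)

text \<open>A union bound over two stages: \<open>B\<close> collects the bad outcomes of the first
  stage, for which the second stage is bounded by 1.\<close>

lemma prob_bind_pmf_le:
  assumes fin: "finite (set_pmf p)" "\<And>x. x \<in> set_pmf p \<Longrightarrow> finite (set_pmf (f x))"
    and le: "\<And>x. x \<in> set_pmf p \<Longrightarrow> x \<notin> B \<Longrightarrow> measure_pmf.prob (f x) A \<le> c"
    and "0 \<le> c"
  shows "measure_pmf.prob (bind_pmf p f) A \<le> measure_pmf.prob p B + c"
proof -
  have "measure_pmf.prob (bind_pmf p f) A = measure_pmf.expectation (bind_pmf p f) (indicator A)"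
    by simp
  also have "\<dots> = measure_pmf.expectation p (\<lambda>x. measure_pmf.prob (f x) A)"
    by (subst expectation_bind_pmf_finite) (use fin in auto)
  also have "\<dots> \<le> measure_pmf.expectation p (\<lambda>x. indicator B x + c)"
    using le \<open>0 \<le> c\<close>
    by (intro expectation_mono_finite fin)
      (auto simp: indicator_def intro: order_trans[OF measure_pmf.prob_le_1])
  also have "\<dots> = measure_pmf.prob p B + c"
    by (subst Bochner_Integration.integral_add)
      (auto intro: integrable_measure_pmf_finite fin)
  finally show ?thesis .
qed

lemma prob_cond_pmf:
  assumes "set_pmf p \<inter> S \<noteq> {}"
  shows "measure_pmf.prob (cond_pmf p S) A = measure_pmf.prob p (A \<inter> S) / measure_pmf.prob p S"
  using assms measure_measure_pmf_not_zero[of p S]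
  by (subst cond_pmf.rep_eq[OF assms])
    (simp add: measure_uniform_measure emeasure_measure_pmf_not_zero Int_commute)

section \<open>Combining oracle algorithms\<close>

text \<open>
  Algorithms returning a value of arbitrary type are written in continuation-passing style.
  \<open>simulates n D F p c\<close>: against the oracle for \<open>D\<close>, \<open>F\<close> passes a sample of \<open>p\<close> to its
  continuation after at most \<open>c\<close> queries, all of them admissible.
\<close>

definition well_queried :: "nat \<Rightarrow> nat pmf \<Rightarrow> nat \<Rightarrow> intcond_algorithm \<Rightarrow> bool" where
  "well_queried n D c A \<longleftrightarrow>
     (\<forall>(v, qs) \<in> set_pmf (run D A). length qs \<le> c \<and> (\<forall>S \<in> set qs. admissible_query n D S))"

definition simulates ::
    "nat \<Rightarrow> nat pmf \<Rightarrow> (('a \<Rightarrow> intcond_algorithm) \<Rightarrow> intcond_algorithm) \<Rightarrow> 'a pmf \<Rightarrow> nat \<Rightarrow> bool" where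
  "simulates n D F p c \<longleftrightarrow>
     (\<forall>k. map_pmf fst (run D (F k)) = bind_pmf p (\<lambda>x. map_pmf fst (run D (k x)))) \<and>
     (\<forall>k d. (\<forall>x \<in> set_pmf p. well_queried n D d (k x)) \<longrightarrow> well_queried n D (c + d) (F k))"

lemma simulates_return: "simulates n D (\<lambda>k. k x) (return_pmf x) 0"
  by (simp add: simulates_def bind_return_pmf)

text \<open>\<open>G x\<close> is constrained only for \<open>x\<close> in the support of
  \<open>p\<close>, so the admissibility of a later query may rest on an earlier answer having
  positive mass.\<close>

lemma simulates_bind:
  assumes "simulates n D F p c" "\<And>x. x \<in> set_pmf p \<Longrightarrow> simulates n D (G x) (r x) d"
  shows "simulates n D (\<lambda>k. F (\<lambda>x. G x k)) (bind_pmf p r) (c + d)"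
proof -
  have "bind_pmf p (\<lambda>x. map_pmf fst (run D (G x k))) =
      bind_pmf p (\<lambda>x. bind_pmf (r x) (\<lambda>y. map_pmf fst (run D (k y))))" for k
    using assms(2) by (intro bind_pmf_cong) (auto simp: simulates_def)
  then show ?thesis
    using assms unfolding simulates_def
    by (auto simp: bind_assoc_pmf add.assoc)
qed

lemma simulates_Random: "simulates n D (Random p) p 0"
  by (auto simp: simulates_def well_queried_def map_bind_pmf)

lemma simulates_Query:
  assumes "admissible_query n D (a, b)"
  shows "simulates n D (Query a b) (intcond D a b) 1"
  unfolding simulates_def
proof (intro conjI allI impI)
  fix k
  show "map_pmf fst (run D (Query a b k)) =
      bind_pmf (intcond D a b) (\<lambda>x. map_pmf fst (run D (k x)))"
    by (simp add: map_bind_pmf pmf.map_comp o_def case_prod_beta)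
next
  fix k d
  assume *: "\<forall>x\<in>set_pmf (intcond D a b). well_queried n D d (k x)"
  show "well_queried n D (1 + d) (Query a b k)"
    unfolding well_queried_def using * assms by (fastforce simp: well_queried_def)
qed

primrec iterate_alg ::
    "nat \<Rightarrow> (('a \<Rightarrow> intcond_algorithm) \<Rightarrow> intcond_algorithm) \<Rightarrow>
     ('a list \<Rightarrow> intcond_algorithm) \<Rightarrow> intcond_algorithm" where
  "iterate_alg 0 F k = k []"
| "iterate_alg (Suc m) F k = F (\<lambda>x. iterate_alg m F (\<lambda>xs. k (x # xs)))"

lemma simulates_iterate:
  assumes "simulates n D F p c"
  shows "simulates n D (iterate_alg m F) (replicate_pmf m p) (m * c)"
proof (induction m)
  case 0
  have "iterate_alg 0 F = (\<lambda>k. k [])" by (rule ext) simp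
  then show ?case using simulates_return[of n D "[]"] by simp
next
  case (Suc m)
  have eq: "iterate_alg (Suc m) F = (\<lambda>k. F (\<lambda>x. iterate_alg m F (\<lambda>xs. k (x # xs))))"
    by (rule ext) simp
  have "simulates n D (\<lambda>k. F (\<lambda>x. iterate_alg m F (\<lambda>xs. k (x # xs))))
     (bind_pmf p (\<lambda>x. bind_pmf (replicate_pmf m p) (\<lambda>xs. return_pmf (x # xs)))) (c + (m * c + 0))"
    by (intro simulates_bind[OF assms] simulates_bind[OF Suc] simulates_return)
  then show ?case unfolding eq by simp
qed

lemma simulates_Output:
  assumes "simulates n D F p c"
  shows "map_pmf fst (run D (F Output)) = p" "well_queried n D c (F Output)"
proof -
  show "map_pmf fst (run D (F Output)) = p"
    using assms by (simp add: simulates_def bind_return_pmf')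
  have "well_queried n D 0 (Output v)" for v
    by (simp add: well_queried_def)
  with assms show "well_queried n D c (F Output)"
    unfolding simulates_def by fastforce
qed

section \<open>Partitioning into intervals of geometrically growing length\<close>

text \<open>Adding 1 after the floor makes the breakpoints grow by more than the factor 1 + \<eta>,
  while a block starting at \<open>a\<close> contains at most \<eta> \<open>a\<close> points besides
  \<open>a\<close>. Blocks with \<eta> \<open>a\<close> < 1 are singletons.\<close>

fun breakpoint :: "real \<Rightarrow> nat \<Rightarrow> nat" where
  "breakpoint \<eta> 0 = 1"
| "breakpoint \<eta> (Suc j) = nat \<lfloor>(1 + \<eta>) * real (breakpoint \<eta> j)\<rfloor> + 1"

definition block :: "real \<Rightarrow> nat \<Rightarrow> nat set" where
  "block \<eta> j = {breakpoint \<eta> j..<breakpoint \<eta> (Suc j)}"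

lemma breakpoint_pos: "1 \<le> breakpoint \<eta> j"
  by (induction j) auto


lemma breakpoint_Suc_gt:
  assumes "\<eta> > 0"
  shows "(1 + \<eta>) * real (breakpoint \<eta> j) < real (breakpoint \<eta> (Suc j))"
  using assms by simp linarith

lemma breakpoint_Suc_le:
  assumes "\<eta> > 0"
  shows "real (breakpoint \<eta> (Suc j)) \<le> (1 + \<eta>) * real (breakpoint \<eta> j) + 1"
  using assms by simp

declare breakpoint.simps(2) [simp del]

context
  fixes \<eta> :: real
  assumes \<eta>: "\<eta> > 0"
begin

lemma breakpoint_less_Suc: "breakpoint \<eta> j < breakpoint \<eta> (Suc j)"
proof -
  have "real (breakpoint \<eta> j) \<le> (1 + \<eta>) * real (breakpoint \<eta> j)"
    using \<eta> by (simp add: algebra_simps)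
  with breakpoint_Suc_gt[OF \<eta>, of j] show ?thesis by linarith
qed

lemma breakpoint_ge_power: "(1 + \<eta>) ^ j \<le> real (breakpoint \<eta> j)"
proof (induction j)
  case (Suc j)
  have "(1 + \<eta>) ^ Suc j \<le> (1 + \<eta>) * real (breakpoint \<eta> j)"
    using Suc \<eta> by simp
  with breakpoint_Suc_gt[OF \<eta>, of j] show ?case by linarith
qed simp

lemma sum_blocks:
  fixes f :: "nat \<Rightarrow> real"
  shows "(\<Sum>i\<in>{1..<breakpoint \<eta> l}. f i) = (\<Sum>j<l. sum f (block \<eta> j))"
proof (induction l)
  case (Suc l)
  have "sum f {1..<breakpoint \<eta> (Suc l)} =
      sum f {1..<breakpoint \<eta> l} + sum f {breakpoint \<eta> l..<breakpoint \<eta> (Suc l)}"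
    using breakpoint_pos[of \<eta> l] less_imp_le[OF breakpoint_less_Suc[of l]]
    by (simp add: sum.atLeastLessThan_concat)
  with Suc show ?case by (simp add: block_def)
qed simp

text \<open>Summation by parts: a block ending at \<open>b\<close> adds at least
  \<open>(b - a) * f b\<close> to the right-hand side, and the boundary term on the left grows into
  exactly this. Hence the drops weighted by the breakpoints are bounded by the total mass.\<close>

lemma sum_breakpoint_drop_le:
  fixes f :: "nat \<Rightarrow> real"
  assumes "\<And>i j. 1 \<le> i \<Longrightarrow> i \<le> j \<Longrightarrow> f j \<le> f i"
  shows "(\<Sum>j<l. real (breakpoint \<eta> j) * (f (breakpoint \<eta> j) - f (breakpoint \<eta> (Suc j))))
           + real (breakpoint \<eta> l) * f (breakpoint \<eta> l) \<le> (\<Sum>i=1..breakpoint \<eta> l. f i)"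
proof (induction l)
  case (Suc l)
  let ?a = "breakpoint \<eta> l" and ?b = "breakpoint \<eta> (Suc l)"
  have "{1..?b} = {1..?a} \<union> {?a<..?b}" using breakpoint_less_Suc[of l] breakpoint_pos[of \<eta> l] by auto
  then have "sum f {1..?b} = sum f {1..?a} + sum f {?a<..?b}"
    by (simp only:) (rule sum.union_disjoint, auto)
  moreover have "(\<Sum>i\<in>{?a<..?b}. f ?b) \<le> sum f {?a<..?b}"
    using assms breakpoint_pos[of \<eta> l] by (intro sum_mono) auto
  moreover have "(\<Sum>i\<in>{?a<..?b}. f ?b) = (real ?b - real ?a) * f ?b"
    using breakpoint_less_Suc[of l] by (simp add: of_nat_diff)
  ultimately show ?case
    using Suc by (simp add: algebra_simps)
qed simp

end

text \<open>If the differences d = f - g have a nonnegative sum, then d is nonnegative at some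
  \<open>c\<close>. From \<open>c\<close> to any other point, \<open>f\<close> and \<open>g\<close>
  each move by at most their total drop, so d is nowhere below minus the sum of these drops, and |d|
  - d is at most twice that sum.\<close>

lemma sum_abs_diff_antitone_le:
  fixes f g :: "nat \<Rightarrow> real"
  assumes "a \<le> b" and f: "\<And>i j. a \<le> i \<Longrightarrow> i \<le> j \<Longrightarrow> j \<le> b \<Longrightarrow> f j \<le> f i"
    and g: "\<And>i j. a \<le> i \<Longrightarrow> i \<le> j \<Longrightarrow> j \<le> b \<Longrightarrow> g j \<le> g i"
  shows "(\<Sum>i=a..b. \<bar>f i - g i\<bar>) \<le>
           \<bar>\<Sum>i=a..b. f i - g i\<bar> + 2 * (real b - real a) * ((f a - f b) + (g a - g b))"
proof -
  \<comment> \<open>The claim is symmetric in \<open>f\<close> and \<open>g\<close>, so it is proved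
    for one sign of the sum and used with the functions swapped for the other.\<close>
  have main: "(\<Sum>i=a..b. \<bar>f i - g i\<bar>) \<le>
           (\<Sum>i=a..b. f i - g i) + 2 * (real b - real a) * ((f a - f b) + (g a - g b))"
    if f: "\<And>i j. a \<le> i \<Longrightarrow> i \<le> j \<Longrightarrow> j \<le> b \<Longrightarrow> f j \<le> f i"
    and g: "\<And>i j. a \<le> i \<Longrightarrow> i \<le> j \<Longrightarrow> j \<le> b \<Longrightarrow> g j \<le> g i"
    and nn: "0 \<le> (\<Sum>i=a..b. f i - g i)" for f g :: "nat \<Rightarrow> real"
  proof -
    let ?w = "(f a - f b) + (g a - g b)"
    obtain c where c: "c \<in> {a..b}" "0 \<le> f c - g c"
    proof (rule ccontr)
      assume "\<not> thesis"
      then have "\<forall>c\<in>{a..b}. f c - g c < 0" using that by force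
      then have "(\<Sum>i=a..b. f i - g i) < 0" using \<open>a \<le> b\<close> sum_strict_mono[of "{a..b}" "\<lambda>c. f c - g c" "\<lambda>_. 0"] by simp
      with nn show False by simp
    qed
    have w: "0 \<le> ?w" using f[of a b] g[of a b] \<open>a \<le> b\<close> by simp
    have neg: "\<bar>f i - g i\<bar> - (f i - g i) \<le> 2 * ?w" if "i \<in> {a..b}" for i
      using f[of i c] f[of c i] g[of i c] g[of c i] f[of a c] f[of c b] f[of a i] f[of i b]
        g[of a c] g[of c b] g[of a i] g[of i b] that c w by (cases "i \<le> c") auto
    have "(\<Sum>i=a..b. \<bar>f i - g i\<bar>) - (\<Sum>i=a..b. f i - g i) =
        (\<Sum>i=a..b. \<bar>f i - g i\<bar> - (f i - g i))"
      by (simp add: sum_subtractf)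
    \<comment> \<open>The point \<open>c\<close> has no excess, which leaves \<open>b - a\<close>
      points instead of \<open>b - a + 1\<close>; thus a singleton block has no error beyond the
      difference of its weights.\<close>
    also have "\<dots> = (\<Sum>i\<in>{a..b} - {c}. \<bar>f i - g i\<bar> - (f i - g i))"
      using c by (subst sum.remove[of _ c]) auto
    also have "\<dots> \<le> (\<Sum>i\<in>{a..b} - {c}. 2 * ?w)"
      using neg by (intro sum_mono) auto
    also have "\<dots> = 2 * (real b - real a) * ?w"
      using c \<open>a \<le> b\<close> by (simp add: card_Diff_singleton of_nat_diff algebra_simps)
    finally show ?thesis by simp
  qed
  show ?thesis
  proof (cases "0 \<le> (\<Sum>i=a..b. f i - g i)")
    case True
    with main[of f g, OF f g True] show ?thesis by simp
  next
    case False
    then have nn: "0 \<le> (\<Sum>i=a..b. g i - f i)" by (simp add: sum_subtractf)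
    from main[of g f, OF g f nn] False show ?thesis
      by (simp add: sum_subtractf abs_minus_commute add.commute)
  qed
qed

text \<open>Birge's argument: the error inside a block is at most 2 \<eta> times its first point
  times the drops of \<open>f\<close> and \<open>g\<close>. By \<open>sum_breakpoint_drop_le\<close>
  these weighted drops sum to at most 1 for each function, which gives 4 \<eta>.\<close>

lemma sum_abs_diff_blocks_le:
  fixes f g :: "nat \<Rightarrow> real"
  assumes \<eta>: "\<eta> > 0"
    and f: "\<And>i j. 1 \<le> i \<Longrightarrow> i \<le> j \<Longrightarrow> f j \<le> f i" and g: "\<And>i j. 1 \<le> i \<Longrightarrow> i \<le> j \<Longrightarrow> g j \<le> g i"
    and f1: "\<And>m. (\<Sum>i=1..m. f i) \<le> 1" and g1: "\<And>m. (\<Sum>i=1..m. g i) \<le> 1"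
    and f0: "\<And>i. 0 \<le> f i" and g0: "\<And>i. 0 \<le> g i"
  shows "(\<Sum>i\<in>{1..<breakpoint \<eta> l}. \<bar>f i - g i\<bar>) \<le>
           (\<Sum>j<l. \<bar>sum f (block \<eta> j) - sum g (block \<eta> j)\<bar>) + 4 * \<eta>"
proof -
  let ?b = "breakpoint \<eta>"
  let ?d = "\<lambda>h j. real (?b j) * (h (?b j) - h (?b (Suc j)))"
  have drop: "(\<Sum>j<l. ?d h j) \<le> 1"
    if "\<And>i j. 1 \<le> i \<Longrightarrow> i \<le> j \<Longrightarrow> h j \<le> h i" "\<And>m. (\<Sum>i=1..m. h i) \<le> 1" "\<And>i. 0 \<le> h i"
    for h :: "nat \<Rightarrow> real"
    using sum_breakpoint_drop_le[OF \<eta>, of h l] that(1) that(2)[of "?b l"]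
      mult_nonneg_nonneg[OF of_nat_0_le_iff that(3), of "?b l" "?b l"] by fastforce
  have block: "(\<Sum>i\<in>block \<eta> j. \<bar>f i - g i\<bar>) \<le>
      \<bar>sum f (block \<eta> j) - sum g (block \<eta> j)\<bar> + 2 * \<eta> * (?d f j + ?d g j)" for j
  proof -
    define a c where "a = ?b j" and "c = ?b (Suc j)"
    have ac: "1 \<le> a" "a < c" unfolding a_def c_def
      using breakpoint_pos[of \<eta> j] breakpoint_less_Suc[OF \<eta>, of j] \<eta> by simp_all
    have eq: "block \<eta> j = {a..c - 1}" using ac unfolding block_def a_def[symmetric] c_def[symmetric] by auto
    have len: "real (c - 1) - real a \<le> \<eta> * real a"
      using breakpoint_Suc_le[OF \<eta>, of j] ac unfolding a_def[symmetric] c_def[symmetric]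
      by (simp add: of_nat_diff algebra_simps)
    have "(\<Sum>i=a..c - 1. \<bar>f i - g i\<bar>) \<le> \<bar>\<Sum>i=a..c - 1. f i - g i\<bar> +
        2 * (real (c - 1) - real a) * ((f a - f (c - 1)) + (g a - g (c - 1)))"
      using ac by (intro sum_abs_diff_antitone_le f g) auto
    \<comment> \<open>The drop is extended to \<open>c\<close>, the start of the next block, to
      match the form summed by \<open>drop\<close>.\<close>
    also have "2 * (real (c - 1) - real a) * ((f a - f (c - 1)) + (g a - g (c - 1))) \<le>
        2 * (\<eta> * real a) * ((f a - f c) + (g a - g c))"
      using len ac \<eta> f[of "c - 1" c] g[of "c - 1" c] f[of a "c - 1"] g[of a "c - 1"]
      by (intro mult_mono add_mono diff_left_mono) auto
    finally show ?thesis
      unfolding eq a_def[symmetric] c_def[symmetric] by (simp add: sum_subtractf algebra_simps)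
  qed
  have "(\<Sum>i\<in>{1..<?b l}. \<bar>f i - g i\<bar>) = (\<Sum>j<l. \<Sum>i\<in>block \<eta> j. \<bar>f i - g i\<bar>)"
    by (rule sum_blocks[OF \<eta>])
  also have "\<dots> \<le> (\<Sum>j<l. \<bar>sum f (block \<eta> j) - sum g (block \<eta> j)\<bar> + 2 * \<eta> * (?d f j + ?d g j))"
    by (intro sum_mono block)
  also have "\<dots> = (\<Sum>j<l. \<bar>sum f (block \<eta> j) - sum g (block \<eta> j)\<bar>) +
      2 * \<eta> * ((\<Sum>j<l. ?d f j) + (\<Sum>j<l. ?d g j))"
    by (simp only: sum.distrib flip: sum_distrib_left)
  also have "2 * \<eta> * ((\<Sum>j<l. ?d f j) + (\<Sum>j<l. ?d g j)) \<le> 2 * \<eta> * (1 + 1)"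
    using \<eta> by (intro mult_left_mono add_mono drop f g f1 g1 f0 g0) auto
  finally show ?thesis by simp
qed

section \<open>Learning a monotone distribution\<close>

lemma finite_set_distribution: "D \<in> distributions n \<Longrightarrow> finite (set_pmf D)"
  by (auto simp: distributions_def intro: finite_subset)

lemma pmf_distribution_eq_0: "D \<in> distributions n \<Longrightarrow> i \<notin> {1..n} \<Longrightarrow> pmf D i = 0"
  by (auto simp: distributions_def set_pmf_iff)

lemma monotone_distributions_subset: "monotone_distributions n \<subseteq> distributions n"
  by (auto simp: monotone_distributions_def)

lemma monotone_distribution_antitone:
  assumes "D \<in> monotone_distributions n" "1 \<le> i" "i \<le> j"
  shows "pmf D j \<le> pmf D i"
proof (cases "j \<le> n")
  case False
  with assms have "pmf D j = 0"
    by (intro pmf_distribution_eq_0[of D n]) (auto simp: monotone_distributions_def)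
  then show ?thesis by simp
qed (use assms in \<open>auto simp: monotone_distributions_def\<close>)

lemma return_pmf_1_monotone: "1 \<le> n \<Longrightarrow> return_pmf 1 \<in> monotone_distributions n"
  by (auto simp: monotone_distributions_def distributions_def indicator_def)

lemma sum_pmf_le_1: "finite S \<Longrightarrow> (\<Sum>i\<in>S. pmf D i) \<le> 1"
  by (metis measure_measure_pmf_finite measure_pmf.prob_le_1)

lemma tv_dist_nonneg: "0 \<le> tv_dist n D H"
  by (simp add: tv_dist_def sum_nonneg)

lemma tv_dist_to_le:
  assumes "H \<in> C"
  shows "tv_dist_to n D C \<le> tv_dist n D H"
  unfolding tv_dist_to_def
  by (intro cINF_lower bdd_belowI[of _ 0] assms) (auto simp: tv_dist_nonneg)

definition fits :: "real \<Rightarrow> nat \<Rightarrow> nat \<Rightarrow> real \<Rightarrow> nat list \<Rightarrow> nat pmf \<Rightarrow> bool" where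
  "fits \<eta> l N \<tau> xs H \<longleftrightarrow>
     (\<Sum>j<l. \<bar>(\<Sum>x\<leftarrow>xs. indicator (block \<eta> j) x) / real N
               - measure_pmf.prob H (block \<eta> j)\<bar>) \<le> \<tau>"

text \<open>Only queries are counted, so the hypothesis may be any choice depending on the samples.
  The implication keeps it monotone even when no monotone distribution fits; this is what makes a
  far \<open>D\<close> far from every hypothesis.\<close>

definition hypothesis :: "nat \<Rightarrow> real \<Rightarrow> nat \<Rightarrow> nat \<Rightarrow> real \<Rightarrow> nat list \<Rightarrow> nat pmf" where
  "hypothesis n \<eta> l N \<tau> xs =
     (SOME H. H \<in> monotone_distributions n \<and>
        ((\<exists>G\<in>monotone_distributions n. fits \<eta> l N \<tau> xs G) \<longrightarrow> fits \<eta> l N \<tau> xs H))"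

lemma hypothesis:
  assumes "1 \<le> n"
  shows "hypothesis n \<eta> l N \<tau> xs \<in> monotone_distributions n"
    and "G \<in> monotone_distributions n \<Longrightarrow> fits \<eta> l N \<tau> xs G \<Longrightarrow>
           fits \<eta> l N \<tau> xs (hypothesis n \<eta> l N \<tau> xs)"
proof -
  have "\<exists>H. H \<in> monotone_distributions n \<and>
      ((\<exists>G\<in>monotone_distributions n. fits \<eta> l N \<tau> xs G) \<longrightarrow> fits \<eta> l N \<tau> xs H)"
    using return_pmf_1_monotone[OF assms] by blast
  from someI_ex[OF this] show "hypothesis n \<eta> l N \<tau> xs \<in> monotone_distributions n"
    and "G \<in> monotone_distributions n \<Longrightarrow> fits \<eta> l N \<tau> xs G \<Longrightarrow>
           fits \<eta> l N \<tau> xs (hypothesis n \<eta> l N \<tau> xs)"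
    unfolding hypothesis_def by blast+
qed

text \<open>The triangle inequality through the empirical weights costs 2 \<tau>, the passage from
  weights to points 4 \<eta>; total variation halves both.\<close>

lemma tv_dist_fitting_le:
  assumes D: "D \<in> monotone_distributions n" and H: "H \<in> monotone_distributions n"
    and fits: "fits \<eta> l N \<tau> xs D" "fits \<eta> l N \<tau> xs H"
    and "\<eta> > 0" "n < breakpoint \<eta> l"
  shows "tv_dist n D H \<le> \<tau> + 2 * \<eta>"
proof -
  let ?c = "\<lambda>j. (\<Sum>x\<leftarrow>xs. indicator (block \<eta> j) x) / real N"
  let ?P = "\<lambda>G j. measure_pmf.prob G (block \<eta> j)"
  have P: "?P G j = sum (pmf G) (block \<eta> j)" for G j
    by (simp add: measure_measure_pmf_finite block_def)
  have "(\<Sum>i=1..n. \<bar>pmf D i - pmf H i\<bar>) \<le> (\<Sum>i\<in>{1..<breakpoint \<eta> l}. \<bar>pmf D i - pmf H i\<bar>)"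
    using \<open>n < _\<close> by (intro sum_mono2) auto
  also have "\<dots> \<le> (\<Sum>j<l. \<bar>?P D j - ?P H j\<bar>) + 4 * \<eta>"
    unfolding P
    by (intro sum_abs_diff_blocks_le \<open>\<eta> > 0\<close> monotone_distribution_antitone[OF D]
          monotone_distribution_antitone[OF H] sum_pmf_le_1) auto
  also have "(\<Sum>j<l. \<bar>?P D j - ?P H j\<bar>) \<le> (\<Sum>j<l. \<bar>?c j - ?P D j\<bar> + \<bar>?c j - ?P H j\<bar>)"
    by (intro sum_mono) linarith
  also have "\<dots> \<le> \<tau> + \<tau>"
    using fits unfolding fits_def sum.distrib by linarith
  finally show ?thesis by (simp add: tv_dist_def)
qed

text \<open>The blocks are disjoint, so the second moments of their counts sum to at most
  \<open>N\<close>. Cauchy-Schwarz turns the sum of \<open>l\<close> absolute deviations into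
  squares, and Markov's inequality finishes.\<close>

lemma prob_not_fits_le:
  assumes fin: "finite (set_pmf D)" and "N > 0" "\<tau> > 0" "\<eta> > 0"
  shows "measure_pmf.prob (replicate_pmf N D) {xs. \<not> fits \<eta> l N \<tau> xs D} \<le> real l / (real N * \<tau>\<^sup>2)"
proof -
  let ?R = "replicate_pmf N D" and ?P = "\<lambda>j. measure_pmf.prob D (block \<eta> j)"
  define dev where "dev = (\<lambda>j (xs::nat list). (\<Sum>x\<leftarrow>xs. indicator (block \<eta> j) x) - real N * ?P j)"
  define Z where "Z = (\<lambda>xs. \<Sum>j<l. (dev j xs)\<^sup>2)"
  have finR: "finite (set_pmf ?R)" by (rule finite_set_replicate_pmf[OF fin])
  have "measure_pmf.expectation ?R Z = (\<Sum>j<l. measure_pmf.expectation ?R (\<lambda>xs. (dev j xs)\<^sup>2))"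
    unfolding Z_def by (intro Bochner_Integration.integral_sum integrable_measure_pmf_finite finR)
  also have "\<dots> \<le> (\<Sum>j<l. real N * ?P j)"
    using second_moment_replicate[OF fin, of "indicator (block \<eta> j)" N for j]
    by (intro sum_mono) (simp add: dev_def)
  also have "\<dots> = real N * (\<Sum>i\<in>{1..<breakpoint \<eta> l}. pmf D i)"
    unfolding sum_blocks[OF \<open>\<eta> > 0\<close>]
    by (simp add: sum_distrib_left measure_measure_pmf_finite block_def)
  also have "\<dots> \<le> real N"
    by (intro mult_left_le sum_pmf_le_1) auto
  finally have EZ: "measure_pmf.expectation ?R Z \<le> real N" .
  have Z_nonneg: "0 \<le> Z xs" for xs by (simp add: Z_def sum_nonneg)
  have sub: "{xs. \<not> fits \<eta> l N \<tau> xs D} \<subseteq> {xs. real l * Z xs \<ge> (real N * \<tau>)\<^sup>2}"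
  proof safe
    fix xs assume nf: "\<not> fits \<eta> l N \<tau> xs D"
    have eq: "\<bar>(\<Sum>x\<leftarrow>xs. indicator (block \<eta> j) x) / real N - ?P j\<bar> = \<bar>dev j xs\<bar> / real N" for j
    proof -
      have "(\<Sum>x\<leftarrow>xs. indicator (block \<eta> j) x) / real N - ?P j = dev j xs / real N"
        using \<open>N > 0\<close> by (simp add: dev_def field_simps)
      then show ?thesis by simp
    qed
    from nf have "\<tau> < (\<Sum>j<l. \<bar>dev j xs\<bar>) / real N"
      unfolding fits_def eq by (simp add: sum_divide_distrib)
    then have "real N * \<tau> \<le> (\<Sum>j<l. \<bar>dev j xs\<bar>)"
      using \<open>N > 0\<close> by (simp add: field_simps)
    then have "(real N * \<tau>)\<^sup>2 \<le> (\<Sum>j<l. \<bar>dev j xs\<bar>)\<^sup>2"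
      using assms by (intro power_mono) auto
    also have "\<dots> \<le> real l * Z xs"
      using sum_squared_le_sum_of_squares[of "\<lambda>j. \<bar>dev j xs\<bar>" "{..<l}"]
      by (simp add: Z_def mult.commute)
    finally show "(real N * \<tau>)\<^sup>2 \<le> real l * Z xs" .
  qed
  have "measure_pmf.prob ?R {xs. \<not> fits \<eta> l N \<tau> xs D} \<le>
      measure_pmf.prob ?R {xs. real l * Z xs \<ge> (real N * \<tau>)\<^sup>2}"
    by (intro measure_pmf.finite_measure_mono sub) auto
  also have "\<dots> \<le> measure_pmf.expectation ?R (\<lambda>xs. real l * Z xs) / (real N * \<tau>)\<^sup>2"
    using assms Z_nonneg by (intro markov_finite finR) auto
  also have "\<dots> \<le> real l * real N / (real N * \<tau>)\<^sup>2"
    using EZ by (simp add: divide_right_mono mult_left_mono)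
  also have "\<dots> = real l / (real N * \<tau>\<^sup>2)"
    using \<open>N > 0\<close> by (simp add: power2_eq_square)
  finally show ?thesis .
qed

section \<open>Comparison along the dyadic tree\<close>

text \<open>Levels are counted from the leaves: level 0 is \<open>D\<close> itself, and cell
  \<open>q\<close> of level \<open>Suc s\<close> has the children \<open>2 * q\<close> and
  \<open>2 * q + 1\<close> at level \<open>s\<close>.\<close>

definition coarsen :: "nat pmf \<Rightarrow> nat \<Rightarrow> nat pmf" where
  "coarsen D s = map_pmf (\<lambda>i. i div 2 ^ s) D"

lemma pmf_coarsen: "pmf (coarsen D s) q = measure_pmf.prob D {i. i div 2 ^ s = q}"
  by (simp add: coarsen_def pmf_map vimage_def)

lemma pmf_coarsen_Suc:
  "pmf (coarsen D (Suc s)) q = pmf (coarsen D s) (2 * q) + pmf (coarsen D s) (2 * q + 1)"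
proof -
  have "i div 2 ^ Suc s = (i div 2 ^ s) div 2" for i :: nat
    by (simp only: power_Suc2 div_mult2_eq)
  moreover have "k div 2 = q \<longleftrightarrow> k = 2 * q \<or> k = 2 * q + 1" for k :: nat
    by presburger
  ultimately have "{i. i div 2 ^ Suc s = q} =
      {i. i div 2 ^ s = 2 * q} \<union> {i. i div 2 ^ s = 2 * q + 1}"
    by (simp only: Collect_disj_eq)
  then show ?thesis
    unfolding pmf_coarsen by (simp add: measure_pmf.finite_measure_Union[symmetric] disjoint_iff)
qed

lemma pmf_coarsen_eq_0:
  assumes "D \<in> distributions n" "q > n"
  shows "pmf (coarsen D s) q = 0"
proof -
  have "q \<notin> set_pmf (coarsen D s)"
  proof
    assume "q \<in> set_pmf (coarsen D s)"
    then obtain i where "i \<in> set_pmf D" "q = i div 2 ^ s" by (auto simp: coarsen_def)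
    moreover from this assms have "i \<le> n" by (auto simp: distributions_def)
    ultimately show False using \<open>q > n\<close> div_le_dividend[of i "2 ^ s"] by linarith
  qed
  then show ?thesis by (simp add: set_pmf_iff)
qed

text \<open>If the cell \<open>q\<close> of level \<open>s + 1\<close> has mass 0, this is \<open>0 / 0 = 0\<close>, which is harmless below.\<close>

definition left_ratio :: "nat pmf \<Rightarrow> nat \<Rightarrow> nat \<Rightarrow> real" where
  "left_ratio D s q = pmf (coarsen D s) (2 * q) / pmf (coarsen D (Suc s)) q"

lemma left_ratio_range: "0 \<le> left_ratio D s q" "left_ratio D s q \<le> 1"
  using pmf_nonneg[of "coarsen D s" "2 * q"] pmf_nonneg[of "coarsen D s" "2 * q + 1"]
  unfolding left_ratio_def pmf_coarsen_Suc divide_le_eq_1 by (simp, linarith)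

text \<open>A cell of mass 0 has children of mass 0, so the products are right whatever value the
  ratio takes there.\<close>

lemma left_ratio_mult:
  "pmf (coarsen D (Suc s)) q * left_ratio D s q = pmf (coarsen D s) (2 * q)"
  "pmf (coarsen D (Suc s)) q * (1 - left_ratio D s q) = pmf (coarsen D s) (2 * q + 1)"
proof -
  have "pmf (coarsen D (Suc s)) q = 0 \<Longrightarrow> pmf (coarsen D s) (2 * q) = 0"
    using pmf_nonneg[of "coarsen D s" "2 * q"] pmf_nonneg[of "coarsen D s" "2 * q + 1"]
    unfolding pmf_coarsen_Suc by linarith
  then show *: "pmf (coarsen D (Suc s)) q * left_ratio D s q = pmf (coarsen D s) (2 * q)"
    by (auto simp: left_ratio_def)
  from * show "pmf (coarsen D (Suc s)) q * (1 - left_ratio D s q) = pmf (coarsen D s) (2 * q + 1)"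
    using pmf_coarsen_Suc[of D s q] by (simp add: algebra_simps)
qed

definition level_error :: "nat pmf \<Rightarrow> nat pmf \<Rightarrow> nat \<Rightarrow> real" where
  "level_error D H s = measure_pmf.expectation D
     (\<lambda>i. \<bar>left_ratio D s (i div 2 ^ Suc s) - left_ratio H s (i div 2 ^ Suc s)\<bar>)"

text \<open>The l1 distance of the coarsenings, without the factor 1/2 of total variation. The range
  \<open>q \<le> n\<close> contains the support at every level.\<close>

definition coarse_dist :: "nat \<Rightarrow> nat pmf \<Rightarrow> nat pmf \<Rightarrow> nat \<Rightarrow> real" where
  "coarse_dist n D H s = (\<Sum>q\<le>n. \<bar>pmf (coarsen D s) q - pmf (coarsen H s) q\<bar>)"

context
  fixes n :: nat and D H :: "nat pmf"
  assumes D: "D \<in> distributions n" and H: "H \<in> distributions n"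
begin

lemma level_error_eq:
  "level_error D H s =
     (\<Sum>q\<le>n. pmf (coarsen D (Suc s)) q * \<bar>left_ratio D s q - left_ratio H s q\<bar>)"
proof -
  have "level_error D H s =
      measure_pmf.expectation (coarsen D (Suc s)) (\<lambda>q. \<bar>left_ratio D s q - left_ratio H s q\<bar>)"
    by (simp add: level_error_def coarsen_def)
  also have "\<dots> = (\<Sum>q\<le>n. pmf (coarsen D (Suc s)) q *\<^sub>R \<bar>left_ratio D s q - left_ratio H s q\<bar>)"
    using pmf_coarsen_eq_0[OF D, of _ "Suc s"]
    by (intro integral_measure_pmf) (auto simp: set_pmf_iff not_less[symmetric])
  finally show ?thesis by simp
qed

lemma coarse_dist_split:
  "coarse_dist n D H s =
     (\<Sum>q\<le>n. \<bar>pmf (coarsen D s) (2 * q) - pmf (coarsen H s) (2 * q)\<bar>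
           + \<bar>pmf (coarsen D s) (2 * q + 1) - pmf (coarsen H s) (2 * q + 1)\<bar>)"
proof -
  let ?g = "\<lambda>q. \<bar>pmf (coarsen D s) q - pmf (coarsen H s) q\<bar>"
  have double: "(\<Sum>q<m. g (2 * q) + g (2 * q + 1)) = (\<Sum>q<2 * m. g q)" for m and g :: "nat \<Rightarrow> real"
    by (induction m) (auto simp: algebra_simps)
  \<comment> \<open>Indices above \<open>n\<close> carry no mass, so the range can be enlarged to an
    even length and grouped into pairs of siblings.\<close>
  have "coarse_dist n D H s = (\<Sum>q<2 * Suc n. ?g q)"
    unfolding coarse_dist_def
    by (intro sum.mono_neutral_left) (auto simp: pmf_coarsen_eq_0[OF D] pmf_coarsen_eq_0[OF H])
  also have "\<dots> = (\<Sum>q<Suc n. ?g (2 * q) + ?g (2 * q + 1))"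
    by (rule double[symmetric])
  finally show ?thesis by (simp add: lessThan_Suc_atMost)
qed

text \<open>For a cell with masses d, h and ratios r, t, write d r - h t = d (r - t) + (d - h) t,
  and likewise for the right child. The weights t and 1 - t recombine the inherited error to |d -
  h|; each child adds d |r - t|.\<close>

lemma coarse_dist_le_Suc: "coarse_dist n D H s \<le> coarse_dist n D H (Suc s) + 2 * level_error D H s"
proof -
  have "\<bar>pmf (coarsen D s) (2 * q) - pmf (coarsen H s) (2 * q)\<bar>
      + \<bar>pmf (coarsen D s) (2 * q + 1) - pmf (coarsen H s) (2 * q + 1)\<bar>
      \<le> \<bar>pmf (coarsen D (Suc s)) q - pmf (coarsen H (Suc s)) q\<bar>
        + 2 * (pmf (coarsen D (Suc s)) q * \<bar>left_ratio D s q - left_ratio H s q\<bar>)" for q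
  proof -
    let ?d = "pmf (coarsen D (Suc s)) q" and ?h = "pmf (coarsen H (Suc s)) q"
    let ?r = "left_ratio D s q" and ?t = "left_ratio H s q"
    have "\<bar>?d * ?r - ?h * ?t\<bar> = \<bar>?d * (?r - ?t) + (?d - ?h) * ?t\<bar>"
      by (simp add: algebra_simps)
    also have "\<dots> \<le> ?d * \<bar>?r - ?t\<bar> + \<bar>?d - ?h\<bar> * ?t"
      by (rule order_trans[OF abs_triangle_ineq]) (simp add: abs_mult left_ratio_range)
    finally have 1: "\<bar>?d * ?r - ?h * ?t\<bar> \<le> ?d * \<bar>?r - ?t\<bar> + \<bar>?d - ?h\<bar> * ?t" .
    have "\<bar>?d * (1 - ?r) - ?h * (1 - ?t)\<bar> = \<bar>?d * (?t - ?r) + (?d - ?h) * (1 - ?t)\<bar>"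
      by (simp add: algebra_simps)
    also have "\<dots> \<le> ?d * \<bar>?r - ?t\<bar> + \<bar>?d - ?h\<bar> * (1 - ?t)"
      by (rule order_trans[OF abs_triangle_ineq])
        (simp add: abs_mult left_ratio_range abs_minus_commute)
    finally have 2: "\<bar>?d * (1 - ?r) - ?h * (1 - ?t)\<bar> \<le> ?d * \<bar>?r - ?t\<bar> + \<bar>?d - ?h\<bar> * (1 - ?t)" .
    show ?thesis
      using 1 2 unfolding left_ratio_mult by (simp add: algebra_simps)
  qed
  then have "coarse_dist n D H s \<le> (\<Sum>q\<le>n. \<bar>pmf (coarsen D (Suc s)) q - pmf (coarsen H (Suc s)) q\<bar>
        + 2 * (pmf (coarsen D (Suc s)) q * \<bar>left_ratio D s q - left_ratio H s q\<bar>))"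
    unfolding coarse_dist_split by (rule sum_mono)
  then show ?thesis
    by (simp add: coarse_dist_def level_error_eq sum.distrib sum_distrib_left)
qed

text \<open>The same identity solved for d (r - t), using t \<le> 1: a difference of ratios is
  charged to the error at the children and at the cell itself.\<close>

lemma level_error_le: "level_error D H s \<le> coarse_dist n D H s + coarse_dist n D H (Suc s)"
proof -
  have "pmf (coarsen D (Suc s)) q * \<bar>left_ratio D s q - left_ratio H s q\<bar> \<le>
      (\<bar>pmf (coarsen D s) (2 * q) - pmf (coarsen H s) (2 * q)\<bar>
        + \<bar>pmf (coarsen D s) (2 * q + 1) - pmf (coarsen H s) (2 * q + 1)\<bar>)
      + \<bar>pmf (coarsen D (Suc s)) q - pmf (coarsen H (Suc s)) q\<bar>" for q
  proof -
    let ?d = "pmf (coarsen D (Suc s)) q" and ?h = "pmf (coarsen H (Suc s)) q"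
    let ?r = "left_ratio D s q" and ?t = "left_ratio H s q"
    have "?d * \<bar>?r - ?t\<bar> = \<bar>?d * (?r - ?t)\<bar>" by (simp add: abs_mult)
    also have "\<dots> = \<bar>(?d * ?r - ?h * ?t) - (?d - ?h) * ?t\<bar>" by (simp add: algebra_simps)
    also have "\<dots> \<le> \<bar>?d * ?r - ?h * ?t\<bar> + \<bar>?d - ?h\<bar> * ?t"
      by (rule order_trans[OF abs_triangle_ineq4]) (simp add: abs_mult left_ratio_range)
    also have "\<dots> \<le> \<bar>?d * ?r - ?h * ?t\<bar> + \<bar>?d - ?h\<bar>"
      by (simp add: mult_left_le left_ratio_range)
    finally show ?thesis unfolding left_ratio_mult by linarith
  qed
  then show ?thesis
    unfolding level_error_eq coarse_dist_split[of s]
    by (subst coarse_dist_def, subst sum.distrib[symmetric], intro sum_mono) 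
qed

lemma coarse_dist_Suc_le: "coarse_dist n D H (Suc s) \<le> coarse_dist n D H s"
  unfolding coarse_dist_split[of s] unfolding coarse_dist_def pmf_coarsen_Suc
  by (intro sum_mono) linarith

lemma coarse_dist_0: "coarse_dist n D H 0 = 2 * tv_dist n D H"
proof -
  have "(\<Sum>q\<le>n. \<bar>pmf D q - pmf H q\<bar>) = (\<Sum>q=1..n. \<bar>pmf D q - pmf H q\<bar>)"
    using pmf_distribution_eq_0[OF D] pmf_distribution_eq_0[OF H]
    by (intro sum.mono_neutral_right) auto
  then show ?thesis by (simp add: coarse_dist_def coarsen_def tv_dist_def)
qed

lemma coarse_dist_top:
  assumes "n < 2 ^ L"
  shows "coarse_dist n D H L = 0"
proof -
  have "coarsen G L = return_pmf 0" if "G \<in> distributions n" for G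
  proof -
    have "map_pmf (\<lambda>i. i div 2 ^ L) G = map_pmf (\<lambda>i. 0) G"
    proof (rule map_pmf_cong)
      fix i assume "i \<in> set_pmf G"
      with that have "i \<le> n" by (auto simp: distributions_def)
      with assms have "i < 2 ^ L" by linarith
      then show "i div 2 ^ L = 0" by simp
    qed simp
    then show ?thesis by (simp add: coarsen_def)
  qed
  with D H show ?thesis by (simp add: coarse_dist_def)
qed

text \<open>Coarsening contracts the l1 distance, so both terms of \<open>level_error_le\<close> are
  at most its value \<open>2 * tv_dist n D H\<close> at the leaves.\<close>

lemma level_error_le_tv_dist: "level_error D H s \<le> 4 * tv_dist n D H"
proof -
  have "coarse_dist n D H s \<le> 2 * tv_dist n D H" for s
    by (induction s) (simp add: coarse_dist_0, rule order_trans[OF coarse_dist_Suc_le])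
  from add_mono[OF this[of s] this[of "Suc s"]] level_error_le[of s] show ?thesis by linarith
qed

text \<open>Telescoping \<open>coarse_dist_le_Suc\<close> from the leaves to level \<open>L\<close>,
  where a single cell holds all mass; the factors 2 cancel.\<close>

lemma tv_dist_le_sum_level_error:
  assumes "n < 2 ^ L"
  shows "tv_dist n D H \<le> (\<Sum>s<L. level_error D H s)"
proof -
  have "coarse_dist n D H 0 \<le> coarse_dist n D H m + 2 * (\<Sum>s<m. level_error D H s)" for m
  proof (induction m)
    case (Suc m)
    with coarse_dist_le_Suc[of m] show ?case by (simp add: algebra_simps)
  qed simp
  from this[of L] coarse_dist_top[OF assms] coarse_dist_0 show ?thesis by simp
qed

end

section \<open>The tester\<close>

definition cell_lo :: "nat \<Rightarrow> nat \<Rightarrow> nat" where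
  "cell_lo s q = max 1 (q * 2 ^ s)"

definition cell_hi :: "nat \<Rightarrow> nat \<Rightarrow> nat \<Rightarrow> nat" where
  "cell_hi n s q = min n (q * 2 ^ s + 2 ^ s - 1)"

lemma mem_cell:
  assumes "i \<in> {1..n}"
  shows "i \<in> {cell_lo s q..cell_hi n s q} \<longleftrightarrow> i div 2 ^ s = q"
proof -
  have "i div 2 ^ s = q \<longleftrightarrow> q * 2 ^ s \<le> i \<and> i < Suc q * 2 ^ s"
    using dividend_less_times_div[of "2 ^ s" i] div_nat_eqI[of "2 ^ s" q i]
    by (auto simp: algebra_simps)
  moreover have "i < Suc q * 2 ^ s \<longleftrightarrow> i \<le> q * 2 ^ s + 2 ^ s - 1"
  proof -
    have "i < p + r \<longleftrightarrow> i \<le> r + p - 1" if "0 < p" for p r :: nat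
      using that by arith
    then show ?thesis by simp
  qed
  ultimately show ?thesis
    using assms by (auto simp: cell_lo_def cell_hi_def)
qed

lemma intcond_full:
  assumes "D \<in> distributions n"
  shows "intcond D 1 n = D"
proof -
  have "set_pmf D \<subseteq> {1..n}" using assms by (simp add: distributions_def)
  then have "measure_pmf.prob D {1..n} = 1"
    by (simp add: measure_pmf.prob_eq_1 AE_measure_pmf_iff subset_iff)
  then show ?thesis
    using pmf_distribution_eq_0[OF assms] by (intro pmf_eqI) (auto simp: pmf_intcond)
qed

text \<open>Clipping a cell to \<open>{1..n}\<close> removes only points outside the support of
  \<open>D\<close>.\<close>

lemma cell_Int:
  assumes "D \<in> distributions n"
  shows "measure_pmf.prob D (A \<inter> {cell_lo s q..cell_hi n s q}) =
           measure_pmf.prob D (A \<inter> {i. i div 2 ^ s = q})"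
proof (rule measure_prob_cong_0)
  fix x
  assume "x \<in> A \<inter> {cell_lo s q..cell_hi n s q} - A \<inter> {i. i div 2 ^ s = q}"
  then show "pmf D x = 0"
    using mem_cell[of x n s q] pmf_distribution_eq_0[OF assms, of x] by auto
next
  fix x
  assume "x \<in> A \<inter> {i. i div 2 ^ s = q} - A \<inter> {cell_lo s q..cell_hi n s q}"
  then show "pmf D x = 0"
    using mem_cell[of x n s q] pmf_distribution_eq_0[OF assms, of x] by auto
qed

text \<open>The queried cell contains a point of the support, hence has positive mass.\<close>

lemma admissible_cell:
  assumes "D \<in> distributions n" "i \<in> set_pmf D"
  shows "admissible_query n D (cell_lo s (i div 2 ^ s), cell_hi n s (i div 2 ^ s))"
proof -
  let ?I = "{cell_lo s (i div 2 ^ s)..cell_hi n s (i div 2 ^ s)}"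
  have "i \<in> {1..n}" using assms by (auto simp: distributions_def)
  then have i: "i \<in> ?I" using mem_cell by blast
  then have "measure_pmf.prob D ?I > 0" by (rule measure_pmf_posI[OF assms(2)])
  moreover have "cell_lo s (i div 2 ^ s) \<le> cell_hi n s (i div 2 ^ s)" using i by auto
  ultimately show ?thesis by (simp add: admissible_query_def cell_lo_def cell_hi_def)
qed

lemma prob_intcond_left:
  fixes s :: nat
  assumes "D \<in> distributions n" "i \<in> set_pmf D"
  defines "q \<equiv> i div 2 ^ Suc s"
  shows "measure_pmf.prob (intcond D (cell_lo (Suc s) q) (cell_hi n (Suc s) q))
           {x. x div 2 ^ s = 2 * q} = left_ratio D s q"
proof -
  let ?I = "{cell_lo (Suc s) q..cell_hi n (Suc s) q}"
  have "i \<in> {1..n}" using assms by (auto simp: distributions_def)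
  then have "i \<in> ?I" using mem_cell[of i n "Suc s" q] by (simp only: q_def)
  with assms have ne: "set_pmf D \<inter> ?I \<noteq> {}" by blast
  have "x div 2 ^ Suc s = (x div 2 ^ s) div 2" for x :: nat
    by (simp only: power_Suc2 div_mult2_eq)
  then have "{x. x div 2 ^ s = 2 * q} \<inter> {x. x div 2 ^ Suc s = q} = {x. x div 2 ^ s = 2 * q}"
    by auto
  then show ?thesis
    using cell_Int[OF assms(1), of "{x. x div 2 ^ s = 2 * q}" "Suc s" q]
      cell_Int[OF assms(1), of UNIV "Suc s" q]
    unfolding intcond_def prob_cond_pmf[OF ne] left_ratio_def pmf_coarsen by simp
qed

section \<open>A verification round, the whole tester, and the mean of a round\<close>

definition ratio_gap :: "nat pmf \<Rightarrow> nat \<Rightarrow> nat \<Rightarrow> nat \<Rightarrow> nat list \<Rightarrow> real" where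
  "ratio_gap H M s q xs =
     \<bar>(\<Sum>x\<leftarrow>xs. indicator {x. x div 2 ^ s = 2 * q} x) / real M - left_ratio H s q\<bar>"

definition cell_pmf :: "nat \<Rightarrow> nat pmf \<Rightarrow> nat \<Rightarrow> nat \<Rightarrow> nat pmf" where
  "cell_pmf n D s i = intcond D (cell_lo (Suc s) (i div 2 ^ Suc s)) (cell_hi n (Suc s) (i div 2 ^ Suc s))"

text \<open>The output distribution that \<open>round_alg\<close> is shown to simulate; all
  probabilities are computed on such distributions, not on decision trees.\<close>

definition round_pmf :: "nat \<Rightarrow> nat \<Rightarrow> nat \<Rightarrow> nat pmf \<Rightarrow> nat pmf \<Rightarrow> real pmf" where
  "round_pmf n L M D H =
     bind_pmf (pmf_of_set {..<L}) (\<lambda>s. bind_pmf D (\<lambda>i.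
       bind_pmf (replicate_pmf M (cell_pmf n D s i)) (\<lambda>xs.
         return_pmf (ratio_gap H M s (i div 2 ^ Suc s) xs))))"

definition round_alg ::
    "nat \<Rightarrow> nat \<Rightarrow> nat \<Rightarrow> nat pmf \<Rightarrow> (real \<Rightarrow> intcond_algorithm) \<Rightarrow> intcond_algorithm" where
  "round_alg n L M H k =
     Random (pmf_of_set {..<L}) (\<lambda>s. Query 1 n (\<lambda>i.
       iterate_alg M (Query (cell_lo (Suc s) (i div 2 ^ Suc s)) (cell_hi n (Suc s) (i div 2 ^ Suc s)))
         (\<lambda>xs. k (ratio_gap H M s (i div 2 ^ Suc s) xs))))"

definition verdict_of :: "real \<Rightarrow> real list \<Rightarrow> verdict" where
  "verdict_of \<theta> ys = (if \<theta> \<le> sum_list ys then REJECT else ACCEPT)"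

definition tester_pmf ::
    "nat \<Rightarrow> nat \<Rightarrow> nat \<Rightarrow> nat \<Rightarrow> nat \<Rightarrow> real \<Rightarrow> (nat list \<Rightarrow> nat pmf) \<Rightarrow> nat pmf \<Rightarrow> verdict pmf" where
  "tester_pmf n L N M m \<theta> learn D =
     bind_pmf (replicate_pmf N D) (\<lambda>xs.
       bind_pmf (replicate_pmf m (round_pmf n L M D (learn xs))) (\<lambda>ys.
         return_pmf (verdict_of \<theta> ys)))"

definition tester_alg ::
    "nat \<Rightarrow> nat \<Rightarrow> nat \<Rightarrow> nat \<Rightarrow> nat \<Rightarrow> real \<Rightarrow> (nat list \<Rightarrow> nat pmf) \<Rightarrow> intcond_algorithm" where
  "tester_alg n L N M m \<theta> learn =
     iterate_alg N (Query 1 n) (\<lambda>xs.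
       iterate_alg m (round_alg n L M (learn xs)) (\<lambda>ys. Output (verdict_of \<theta> ys)))"

context
  fixes n :: nat and D :: "nat pmf"
  assumes D: "D \<in> distributions n"
begin

lemma simulates_sample: "simulates n D (Query 1 n) D 1"
proof -
  have "set_pmf D \<subseteq> {1..n}" using D by (simp add: distributions_def)
  moreover obtain i where i: "i \<in> set_pmf D" using set_pmf_not_empty[of D] by blast
  ultimately have "i \<in> {1..n}" by blast
  then have "admissible_query n D (1, n)"
    using measure_pmf_posI[OF i, of "{1..n}"] by (auto simp: admissible_query_def)
  from simulates_Query[OF this] show ?thesis by (simp only: intcond_full[OF D])
qed

lemma simulates_round: "simulates n D (round_alg n L M H) (round_pmf n L M D H) (1 + M)"
proof -
  have "simulates n D (\<lambda>k. Random (pmf_of_set {..<L}) (\<lambda>s. Query 1 n (\<lambda>i.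
       iterate_alg M (Query (cell_lo (Suc s) (i div 2 ^ Suc s)) (cell_hi n (Suc s) (i div 2 ^ Suc s)))
         (\<lambda>xs. k (ratio_gap H M s (i div 2 ^ Suc s) xs)))))
       (round_pmf n L M D H) (0 + (1 + (M * 1 + 0)))"
    unfolding round_pmf_def cell_pmf_def
    by (intro simulates_bind[OF simulates_Random] simulates_bind[OF simulates_sample]
        simulates_bind[OF simulates_iterate] simulates_Query admissible_cell[OF D] simulates_return)
  moreover have "round_alg n L M H = (\<lambda>k. Random (pmf_of_set {..<L}) (\<lambda>s. Query 1 n (\<lambda>i.
       iterate_alg M (Query (cell_lo (Suc s) (i div 2 ^ Suc s)) (cell_hi n (Suc s) (i div 2 ^ Suc s)))
         (\<lambda>xs. k (ratio_gap H M s (i div 2 ^ Suc s) xs)))))"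
    by (rule ext) (simp add: round_alg_def)
  ultimately show ?thesis by simp
qed

lemma tester_alg:
  "map_pmf fst (run D (tester_alg n L N M m \<theta> learn)) = tester_pmf n L N M m \<theta> learn D"
  "well_queried n D (N + m * (1 + M)) (tester_alg n L N M m \<theta> learn)"
proof -
  let ?F = "\<lambda>k. iterate_alg N (Query 1 n) (\<lambda>xs.
       iterate_alg m (round_alg n L M (learn xs)) (\<lambda>ys. k (verdict_of \<theta> ys)))"
  have "simulates n D ?F (tester_pmf n L N M m \<theta> learn D) (N * 1 + (m * (1 + M) + 0))"
    unfolding tester_pmf_def
    by (intro simulates_bind[OF simulates_iterate[OF simulates_sample]]
        simulates_bind[OF simulates_iterate[OF simulates_round]] simulates_return)
  then have *: "simulates n D ?F (tester_pmf n L N M m \<theta> learn D) (N + m * (1 + M))" by simp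
  show "map_pmf fst (run D (tester_alg n L N M m \<theta> learn)) = tester_pmf n L N M m \<theta> learn D"
    and "well_queried n D (N + m * (1 + M)) (tester_alg n L N M m \<theta> learn)"
    unfolding tester_alg_def by (fact simulates_Output[OF *])+
qed

lemma finite_cell_pmf: "i \<in> set_pmf D \<Longrightarrow> finite (set_pmf (cell_pmf n D s i))"
proof -
  assume i: "i \<in> set_pmf D"
  let ?I = "{cell_lo (Suc s) (i div 2 ^ Suc s)..cell_hi n (Suc s) (i div 2 ^ Suc s)}"
  have "i \<in> {1..n}" using D i by (auto simp: distributions_def)
  then have "i \<in> ?I" using mem_cell[of i n "Suc s"] by blast
  with i have "set_pmf D \<inter> ?I \<noteq> {}" by blast
  then show ?thesis by (simp add: cell_pmf_def intcond_def set_cond_pmf)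
qed

lemma finite_round_pmf: "L > 0 \<Longrightarrow> finite (set_pmf (round_pmf n L M D H))"
  by (auto simp: round_pmf_def set_pmf_of_set lessThan_empty_iff
      intro!: finite_set_replicate_pmf finite_cell_pmf finite_set_distribution[OF D])

lemma round_pmf_range:
  assumes "M > 0" "y \<in> set_pmf (round_pmf n L M D H)"
  shows "0 \<le> y \<and> y \<le> 1"
proof -
  from assms(2) obtain s i xs where xs: "xs \<in> set_pmf (replicate_pmf M (cell_pmf n D s i))"
    and y: "y = ratio_gap H M s (i div 2 ^ Suc s) xs"
    unfolding round_pmf_def by auto
  let ?f = "indicator {x. x div 2 ^ s = 2 * (i div 2 ^ Suc s)} :: nat \<Rightarrow> real"
  have "0 \<le> (\<Sum>x\<leftarrow>xs. ?f x)" by (rule sum_list_nonneg) auto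
  moreover have "(\<Sum>x\<leftarrow>xs. ?f x) \<le> (\<Sum>x\<leftarrow>xs. 1)" by (rule sum_list_mono) (auto simp: indicator_def)
  then have "(\<Sum>x\<leftarrow>xs. ?f x) \<le> real M"
    using xs by (simp add: set_replicate_pmf sum_list_triv)
  ultimately have "0 \<le> (\<Sum>x\<leftarrow>xs. ?f x) / real M" "(\<Sum>x\<leftarrow>xs. ?f x) / real M \<le> 1"
    using \<open>M > 0\<close> by simp_all
  with left_ratio_range[of H s "i div 2 ^ Suc s"] show ?thesis
    unfolding y ratio_gap_def by linarith
qed

text \<open>The empirical ratio has variance at most 1 / M \<le> \<kappa>^2, hence mean absolute
  deviation at most \<kappa>, and the gap to a fixed number changes by no more than the ratio
  does.\<close>

lemma expectation_ratio_gap: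
  fixes s :: nat
  assumes "i \<in> set_pmf D" "M > 0" "\<kappa> > 0" "1 / \<kappa>\<^sup>2 \<le> real M"
  defines "q \<equiv> i div 2 ^ Suc s"
  shows "\<bar>measure_pmf.expectation (replicate_pmf M (cell_pmf n D s i)) (ratio_gap H M s q)
           - \<bar>left_ratio D s q - left_ratio H s q\<bar>\<bar> \<le> \<kappa>"
proof -
  let ?p = "cell_pmf n D s i" and ?r = "left_ratio D s q" and ?t = "left_ratio H s q"
  let ?R = "replicate_pmf M ?p"
  let ?f = "indicator {x. x div 2 ^ s = 2 * q} :: nat \<Rightarrow> real"
  define dev where "dev = (\<lambda>xs. (\<Sum>x\<leftarrow>xs. ?f x) - real M * ?r)"
  have fin: "finite (set_pmf ?p)" by (rule finite_cell_pmf[OF assms(1)])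
  note int = integrable_measure_pmf_finite[OF finite_set_replicate_pmf[OF fin]]
  have "measure_pmf.expectation ?p ?f = ?r"
    using prob_intcond_left[OF D assms(1), of s] by (simp add: cell_pmf_def q_def)
  with second_moment_replicate[OF fin, of ?f M]
  have "measure_pmf.expectation ?R (\<lambda>xs. (dev xs)\<^sup>2) \<le> real M * ?r"
    by (simp add: dev_def)
  also have "\<dots> \<le> real M" by (intro mult_left_le left_ratio_range) simp
  finally have var: "measure_pmf.expectation ?R (\<lambda>xs. (dev xs)\<^sup>2) \<le> real M" .
  have "\<bar>measure_pmf.expectation ?R (ratio_gap H M s q) - \<bar>?r - ?t\<bar>\<bar> =
      \<bar>measure_pmf.expectation ?R (\<lambda>xs. ratio_gap H M s q xs - \<bar>?r - ?t\<bar>)\<bar>"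
    by (simp add: int)
  also have "\<dots> \<le> measure_pmf.expectation ?R (\<lambda>xs. \<bar>ratio_gap H M s q xs - \<bar>?r - ?t\<bar>\<bar>)"
    by (rule integral_abs_bound)
  \<comment> \<open>AM-GM: \<open>2 \<bar>y\<bar> \<le> y\<^sup>2 / \<kappa> + \<kappa>\<close> replaces the Cauchy-Schwarz inequality.\<close>
  also have "\<dots> \<le> measure_pmf.expectation ?R (\<lambda>xs. (dev xs)\<^sup>2 / ((real M)\<^sup>2 * 2 * \<kappa>) + \<kappa> / 2)"
  proof (intro expectation_mono_finite finite_set_replicate_pmf fin)
    fix xs
    have eq: "(\<Sum>x\<leftarrow>xs. ?f x) / real M - ?r = dev xs / real M"
      using \<open>M > 0\<close> by (simp add: dev_def field_simps)
    have "\<bar>ratio_gap H M s q xs - \<bar>?r - ?t\<bar>\<bar> \<le> \<bar>(\<Sum>x\<leftarrow>xs. ?f x) / real M - ?r\<bar>"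
      unfolding ratio_gap_def by linarith
    also have "\<dots> = \<bar>dev xs / real M\<bar>" by (simp only: eq)
    also have "\<dots> \<le> (dev xs / real M)\<^sup>2 / (2 * \<kappa>) + \<kappa> / 2"
    proof -
      have "0 \<le> (\<bar>dev xs / real M\<bar> - \<kappa>)\<^sup>2 / (2 * \<kappa>)" using \<open>\<kappa> > 0\<close> by simp
      also have "\<dots> = (dev xs / real M)\<^sup>2 / (2 * \<kappa>) + \<kappa> / 2 - \<bar>dev xs / real M\<bar>"
        using \<open>\<kappa> > 0\<close> unfolding power2_diff power2_abs
        by (simp add: add_divide_distrib diff_divide_distrib power2_eq_square)
      finally show ?thesis by simp
    qed
    finally show "\<bar>ratio_gap H M s q xs - \<bar>?r - ?t\<bar>\<bar> \<le> (dev xs)\<^sup>2 / ((real M)\<^sup>2 * 2 * \<kappa>) + \<kappa> / 2"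
      by (simp add: power_divide mult.assoc)
  qed
  also have "\<dots> = measure_pmf.expectation ?R (\<lambda>xs. (dev xs)\<^sup>2) / ((real M)\<^sup>2 * 2 * \<kappa>) + \<kappa> / 2"
    by (simp add: int)
  also have "\<dots> \<le> real M / ((real M)\<^sup>2 * 2 * \<kappa>) + \<kappa> / 2"
    using var \<open>\<kappa> > 0\<close> by (intro add_right_mono divide_right_mono) auto
  also have "real M / ((real M)\<^sup>2 * 2 * \<kappa>) = 1 / real M / (2 * \<kappa>)"
    using \<open>M > 0\<close> by (simp add: power2_eq_square)
  also have "1 / real M \<le> \<kappa>\<^sup>2"
    using assms by (simp add: field_simps)
  then have "1 / real M / (2 * \<kappa>) \<le> \<kappa>\<^sup>2 / (2 * \<kappa>)"
    using \<open>\<kappa> > 0\<close> by (intro divide_right_mono) auto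
  also have "\<kappa>\<^sup>2 / (2 * \<kappa>) = \<kappa> / 2"
    using \<open>\<kappa> > 0\<close> by (simp add: power2_eq_square)
  finally show ?thesis by simp
qed

text \<open>With exact ratios, a uniform level and a random point of \<open>D\<close> would give
  precisely the average level error; \<open>expectation_ratio_gap\<close> applies at each level and
  point.\<close>

lemma expectation_round_pmf:
  assumes "L > 0" "M > 0" "\<kappa> > 0" "1 / \<kappa>\<^sup>2 \<le> real M"
  shows "\<bar>measure_pmf.expectation (round_pmf n L M D H) (\<lambda>y. y)
           - (\<Sum>s<L. level_error D H s) / real L\<bar> \<le> \<kappa>"
proof -
  let ?g = "\<lambda>s i. measure_pmf.expectation (replicate_pmf M (cell_pmf n D s i))
      (ratio_gap H M s (i div 2 ^ Suc s))"
  let ?e = "\<lambda>s i. \<bar>left_ratio D s (i div 2 ^ Suc s) - left_ratio H s (i div 2 ^ Suc s)\<bar>"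
  have finD: "finite (set_pmf D)" by (rule finite_set_distribution[OF D])
  note int = integrable_measure_pmf_finite[OF finD]
  have ne: "{..<L} \<noteq> {}" using \<open>L > 0\<close> by auto
  have inner: "measure_pmf.expectation (bind_pmf D (\<lambda>i.
       bind_pmf (replicate_pmf M (cell_pmf n D s i)) (\<lambda>xs.
         return_pmf (ratio_gap H M s (i div 2 ^ Suc s) xs)))) (\<lambda>y. y)
      = measure_pmf.expectation D (?g s)" for s
  proof -
    have "measure_pmf.expectation (bind_pmf D (\<lambda>i.
         map_pmf (ratio_gap H M s (i div 2 ^ Suc s)) (replicate_pmf M (cell_pmf n D s i)))) (\<lambda>y. y)
        = measure_pmf.expectation D (?g s)"
      by (subst expectation_bind_pmf_finite)
        (auto intro!: finD finite_set_replicate_pmf finite_cell_pmf)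
    then show ?thesis by (simp add: map_pmf_def)
  qed
  have E: "measure_pmf.expectation (round_pmf n L M D H) (\<lambda>y. y) =
      (\<Sum>s<L. measure_pmf.expectation D (?g s)) / real L"
    unfolding round_pmf_def
    by (subst pmf_expectation_bind_pmf_of_set[OF ne])
      (auto simp: inner sum_distrib_left divide_inverse mult.commute simp del: power_Suc
        intro!: finD finite_set_replicate_pmf finite_cell_pmf)
  have "\<bar>measure_pmf.expectation D (?g s) - level_error D H s\<bar> \<le> \<kappa>" for s
  proof -
    have "\<bar>measure_pmf.expectation D (?g s) - level_error D H s\<bar> =
        \<bar>measure_pmf.expectation D (\<lambda>i. ?g s i - ?e s i)\<bar>"
      by (simp add: level_error_def int)
    also have "\<dots> \<le> measure_pmf.expectation D (\<lambda>i. \<bar>?g s i - ?e s i\<bar>)"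
      by (rule integral_abs_bound)
    also have "\<dots> \<le> measure_pmf.expectation D (\<lambda>i. \<kappa>)"
      by (intro expectation_mono_finite finD expectation_ratio_gap assms)
    finally show ?thesis by simp
  qed
  then have "(\<Sum>s<L. \<bar>measure_pmf.expectation D (?g s) - level_error D H s\<bar>) \<le> (\<Sum>s<L. \<kappa>)"
    by (intro sum_mono)
  then have "\<bar>\<Sum>s<L. measure_pmf.expectation D (?g s) - level_error D H s\<bar> \<le> real L * \<kappa>"
    by (intro order_trans[OF sum_abs]) simp
  then have "\<bar>(\<Sum>s<L. measure_pmf.expectation D (?g s) - level_error D H s) / real L\<bar> \<le> \<kappa>"
    using \<open>L > 0\<close> by (simp add: field_simps)
  then show ?thesis
    unfolding E by (simp add: sum_subtractf diff_divide_distrib)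
qed

end

section \<open>Tail bounds for the sum over all rounds\<close>

lemma prob_sum_list_large_le:
  fixes R :: "real pmf"
  assumes fin: "finite (set_pmf R)" and range: "\<And>y. y \<in> set_pmf R \<Longrightarrow> 0 \<le> y \<and> y \<le> 1"
    and mean: "measure_pmf.expectation R (\<lambda>y. y) \<le> 9 / 100 * \<beta>" and "\<beta> > 0" "m > 0"
  shows "measure_pmf.prob (replicate_pmf m R) {ys. real m * \<beta> / 2 \<le> sum_list ys} \<le> 18 / 100"
proof -
  \<comment> \<open>Markov's inequality is enough: the mean is at most 9/100 against the threshold
    1/2, in units of \<open>m * \<beta>\<close>.\<close>
  have "measure_pmf.prob (replicate_pmf m R) {ys. real m * \<beta> / 2 \<le> sum_list ys} \<le>
      measure_pmf.expectation (replicate_pmf m R) sum_list / (real m * \<beta> / 2)"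
    using range assms
    by (intro markov_finite finite_set_replicate_pmf fin)
      (auto simp: set_replicate_pmf intro!: sum_list_nonneg)
  also have "measure_pmf.expectation (replicate_pmf m R) sum_list =
      real m * measure_pmf.expectation R (\<lambda>y. y)"
    using expectation_sum_replicate[OF fin, of m "\<lambda>y. y"] by simp
  also have "\<dots> / (real m * \<beta> / 2) \<le> real m * (9 / 100 * \<beta>) / (real m * \<beta> / 2)"
    using assms by (intro divide_right_mono mult_left_mono) auto
  also have "\<dots> = 18 / 100" using assms by simp
  finally show ?thesis .
qed

text \<open>Chebyshev: the threshold is at most (1/2) / (95/100) = 10/19 of the mean, so the sum
  must fall short by 9/19 of it. The mean is at least 19, and the probability at most (19/9)^2 / 19
  = 19/81.\<close>

lemma prob_sum_list_small_le:
  fixes R :: "real pmf"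
  assumes fin: "finite (set_pmf R)" and range: "\<And>y. y \<in> set_pmf R \<Longrightarrow> 0 \<le> y \<and> y \<le> 1"
    and mean: "measure_pmf.expectation R (\<lambda>y. y) \<ge> 95 / 100 * \<beta>" and "\<beta> > 0" "real m * \<beta> \<ge> 20"
  shows "measure_pmf.prob (replicate_pmf m R) {ys. sum_list ys < real m * \<beta> / 2} \<le> 1 / 3"
proof -
  let ?R = "replicate_pmf m R"
  define \<mu> where "\<mu> = measure_pmf.expectation R (\<lambda>y. y)"
  have m: "real m > 0" using assms by (cases m) auto
  have \<mu>: "\<beta> / 2 \<le> 10 / 19 * \<mu>" "\<mu> > 0" using mean \<open>\<beta> > 0\<close> by (simp_all add: \<mu>_def)
  have "real m * (95 / 100 * \<beta>) \<le> real m * \<mu>" using mean by (intro mult_left_mono) (auto simp: \<mu>_def)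
  with assms have big: "19 \<le> real m * \<mu>" by simp
  define c where "c = 9 / 19 * (real m * \<mu>)"
  have c: "c > 0" using big by (simp add: c_def)
  have "{ys. sum_list ys < real m * \<beta> / 2} \<subseteq> {ys. c\<^sup>2 \<le> (sum_list ys - real m * \<mu>)\<^sup>2}"
  proof safe
    fix ys :: "real list" assume ys: "sum_list ys < real m * \<beta> / 2"
    have "real m * (\<beta> / 2) \<le> real m * (10 / 19 * \<mu>)" using \<mu> by (intro mult_left_mono) auto
    then have "real m * \<beta> / 2 \<le> 10 / 19 * (real m * \<mu>)" by (simp only: times_divide_eq_right mult.left_commute)
    with ys have "c \<le> real m * \<mu> - sum_list ys" unfolding c_def by linarith
    with c have "c\<^sup>2 \<le> (real m * \<mu> - sum_list ys)\<^sup>2" by (intro power_mono) auto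
    then show "c\<^sup>2 \<le> (sum_list ys - real m * \<mu>)\<^sup>2" by (simp add: power2_commute)
  qed
  then have "measure_pmf.prob ?R {ys. sum_list ys < real m * \<beta> / 2} \<le>
      measure_pmf.prob ?R {ys. c\<^sup>2 \<le> (sum_list ys - real m * \<mu>)\<^sup>2}"
    by (intro measure_pmf.finite_measure_mono) auto
  also have "\<dots> \<le> measure_pmf.expectation ?R (\<lambda>ys. (sum_list ys - real m * \<mu>)\<^sup>2) / c\<^sup>2"
    using c by (intro markov_finite finite_set_replicate_pmf fin) auto
  also have "\<dots> \<le> real m * \<mu> / c\<^sup>2"
    using second_moment_replicate[OF fin, of "\<lambda>y. y" m] range
    by (intro divide_right_mono) (auto simp: \<mu>_def)
  also have "\<dots> = (19 / 9)\<^sup>2 / (real m * \<mu>)"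
    using big by (simp add: c_def power2_eq_square field_simps)
  also have "\<dots> \<le> (19 / 9)\<^sup>2 / 19"
    using big by (intro divide_left_mono) auto
  also have "\<dots> \<le> 1 / 3" by (simp add: power2_eq_square)
  finally show ?thesis .
qed

text \<open>
  With \<open>\<beta> = gap n \<epsilon>\<close>, the learner of a monotone \<open>D\<close> errs by at most \<open>\<beta> / 200 + 2 (\<beta> / 400) = \<beta> / 100\<close>,
  so that a round has mean at most \<open>4 \<beta> / 100 + \<beta> / 20 = 9 \<beta> / 100\<close>; it has mean at least
  \<open>\<beta> - \<beta> / 20\<close> if \<open>D\<close> is far from monotone. The term \<open>\<beta> / 20\<close> is the sampling error of the ratios.
\<close>

definition depth :: "nat \<Rightarrow> nat" where
  "depth n = nat \<lfloor>log 2 (real n)\<rfloor> + 1"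

definition gap :: "nat \<Rightarrow> real \<Rightarrow> real" where
  "gap n \<epsilon> = \<epsilon> / real (depth n)"

text \<open>For \<eta> = \<beta> / 400 the bound ln (1 + \<eta>) \<ge> \<eta> / 2 shows that more
  than 2 ln n / \<eta> = 800 ln n / \<beta> blocks reach beyond \<open>n\<close>.\<close>

definition block_count :: "nat \<Rightarrow> real \<Rightarrow> nat" where
  "block_count n \<epsilon> = nat \<lfloor>800 * ln (real n) / gap n \<epsilon>\<rfloor> + 1"

text \<open>Chosen so that the failure bound \<open>l / (N * \<tau>\<^sup>2)\<close> with \<tau> =
  \<beta> / 200 is at most 1/10.\<close>

definition learning_samples :: "nat \<Rightarrow> real \<Rightarrow> nat" where
  "learning_samples n \<epsilon> = nat \<lceil>400000 * real (block_count n \<epsilon>) / (gap n \<epsilon>)\<^sup>2\<rceil>"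

text \<open>This is 1 / \<kappa>^2 for the accuracy \<kappa> = \<beta> / 20.\<close>

definition cell_samples :: "nat \<Rightarrow> real \<Rightarrow> nat" where
  "cell_samples n \<epsilon> = nat \<lceil>400 / (gap n \<epsilon>)\<^sup>2\<rceil>"

definition rounds :: "nat \<Rightarrow> real \<Rightarrow> nat" where
  "rounds n \<epsilon> = nat \<lceil>20 / gap n \<epsilon>\<rceil>"

definition learner :: "nat \<Rightarrow> real \<Rightarrow> nat list \<Rightarrow> nat pmf" where
  "learner n \<epsilon> =
     hypothesis n (gap n \<epsilon> / 400) (block_count n \<epsilon>) (learning_samples n \<epsilon>) (gap n \<epsilon> / 200)"

definition tester :: "nat \<Rightarrow> real \<Rightarrow> intcond_algorithm" where
  "tester n \<epsilon> =
     tester_alg n (depth n) (learning_samples n \<epsilon>) (cell_samples n \<epsilon>) (rounds n \<epsilon>)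
       (real (rounds n \<epsilon>) * gap n \<epsilon> / 2) (learner n \<epsilon>)"

definition query_bound :: "nat \<Rightarrow> real \<Rightarrow> nat" where
  "query_bound n \<epsilon> = learning_samples n \<epsilon> + rounds n \<epsilon> * (1 + cell_samples n \<epsilon>)"

section \<open>Bounds on the parameters and on the number of queries\<close>

lemma depth_pos: "0 < depth n"
  by (simp add: depth_def)

lemma less_two_power_depth: "1 \<le> n \<Longrightarrow> n < 2 ^ depth n"
proof -
  assume "1 \<le> n"
  then have "real n = 2 powr (log 2 (real n))" by simp
  also have "\<dots> < 2 powr (real (depth n))"
    using \<open>1 \<le> n\<close> by (intro powr_less_mono) (auto simp: depth_def, linarith)
  also have "\<dots> = real (2 ^ depth n)" by (simp add: powr_realpow)
  finally show ?thesis by (simp only: of_nat_less_iff)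
qed

lemma ln_ge_half: "2 \<le> n \<Longrightarrow> 2 / 3 \<le> ln (real n)"
  using ln2_ge_two_thirds ln_le_cancel_iff[of 2 "real n"] by linarith

lemma depth_le: "2 \<le> n \<Longrightarrow> real (depth n) \<le> 3 * ln (real n)"
proof -
  assume n: "2 \<le> n"
  have "real (depth n) \<le> log 2 (real n) + 1"
    using n by (simp add: depth_def)
  also have "1 \<le> log 2 (real n)" using n by simp
  then have "log 2 (real n) + 1 \<le> 2 * log 2 (real n)" by simp
  also have "\<dots> = 2 * (ln (real n) / ln 2)" by (simp add: log_def)
  also have "\<dots> \<le> 2 * (ln (real n) / (2 / 3))"
    using n ln2_ge_two_thirds by (intro mult_left_mono divide_left_mono) auto
  finally show ?thesis by simp
qed

context
  fixes n :: nat and \<epsilon> :: real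
  assumes n: "2 \<le> n" and \<epsilon>: "0 < \<epsilon>" "\<epsilon> \<le> 1"
begin

lemma gap_pos: "0 < gap n \<epsilon>" and gap_le_1: "gap n \<epsilon> \<le> 1"
proof -
  show "0 < gap n \<epsilon>" using \<epsilon> depth_pos by (simp add: gap_def)
  have "1 \<le> real (depth n)" using depth_pos[of n] by linarith
  with \<epsilon> show "gap n \<epsilon> \<le> 1" using depth_pos[of n] by (simp add: gap_def divide_le_eq_1)
qed

lemma less_breakpoint_block_count: "n < breakpoint (gap n \<epsilon> / 400) (block_count n \<epsilon>)"
proof -
  define \<eta> where "\<eta> = gap n \<epsilon> / 400"
  have \<eta>: "0 < \<eta>" "\<eta> \<le> 1 / 2" using gap_pos gap_le_1 by (simp_all add: \<eta>_def)
  have "\<eta> * \<eta> \<le> \<eta> * (1 / 2)" using \<eta> by (intro mult_left_mono) auto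
  then have "\<eta> / 2 \<le> \<eta> - \<eta>\<^sup>2" by (simp add: power2_eq_square)
  also have "\<dots> \<le> ln (1 + \<eta>)"
    using \<eta> by (intro ln_one_plus_pos_lower_bound) auto
  finally have ln: "\<eta> / 2 \<le> ln (1 + \<eta>)" .
  have "2 * ln (real n) / \<eta> = 800 * ln (real n) / gap n \<epsilon>" by (simp add: \<eta>_def)
  also have "\<dots> < real (block_count n \<epsilon>)"
    unfolding block_count_def by (simp, linarith)
  finally have "ln (real n) < real (block_count n \<epsilon>) * (\<eta> / 2)"
    using \<eta> by (simp add: field_simps)
  also have "\<dots> \<le> real (block_count n \<epsilon>) * ln (1 + \<eta>)"
    by (intro mult_left_mono ln) auto
  also have "\<dots> = ln ((1 + \<eta>) ^ block_count n \<epsilon>)"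
    using \<eta> by (simp add: ln_realpow)
  finally have "real n < (1 + \<eta>) ^ block_count n \<epsilon>"
    using n \<eta> by simp
  also have "\<dots> \<le> real (breakpoint \<eta> (block_count n \<epsilon>))"
    by (rule breakpoint_ge_power[OF \<eta>(1)])
  finally show ?thesis by (simp add: \<eta>_def)
qed

lemma learning_samples_ge:
  "400000 * real (block_count n \<epsilon>) / (gap n \<epsilon>)\<^sup>2 \<le> real (learning_samples n \<epsilon>)"
  "0 < learning_samples n \<epsilon>"
proof -
  show *: "400000 * real (block_count n \<epsilon>) / (gap n \<epsilon>)\<^sup>2 \<le> real (learning_samples n \<epsilon>)"
    unfolding learning_samples_def by linarith
  have "0 < 400000 * real (block_count n \<epsilon>) / (gap n \<epsilon>)\<^sup>2"
    using gap_pos by (simp add: block_count_def add_pos_nonneg)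
  with * show "0 < learning_samples n \<epsilon>" by simp
qed

lemma cell_samples_ge:
  "1 / (gap n \<epsilon> / 20)\<^sup>2 \<le> real (cell_samples n \<epsilon>)" "0 < cell_samples n \<epsilon>"
proof -
  have eq: "1 / (gap n \<epsilon> / 20)\<^sup>2 = 400 / (gap n \<epsilon>)\<^sup>2" by (simp add: power_divide)
  show *: "1 / (gap n \<epsilon> / 20)\<^sup>2 \<le> real (cell_samples n \<epsilon>)"
    unfolding cell_samples_def eq by linarith
  have "0 < 1 / (gap n \<epsilon> / 20)\<^sup>2" using gap_pos by simp
  with * show "0 < cell_samples n \<epsilon>" by linarith
qed

lemma rounds_ge: "20 \<le> real (rounds n \<epsilon>) * gap n \<epsilon>" "0 < rounds n \<epsilon>"
proof -
  have *: "20 / gap n \<epsilon> \<le> real (rounds n \<epsilon>)" unfolding rounds_def by linarith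
  with gap_pos show "20 \<le> real (rounds n \<epsilon>) * gap n \<epsilon>" by (simp add: field_simps)
  then show "0 < rounds n \<epsilon>" by (cases "rounds n \<epsilon>") auto
qed

text \<open>With \<open>u\<close> an upper bound for 1 / \<beta>, learning costs O(w u) blocks times
  u^2, and verification O(u) rounds of O(u^2) queries. The lower bounds on \<open>w\<close> and
  \<open>u\<close> absorb the roundings.\<close>

lemma query_bound_le: "real (query_bound n \<epsilon>) \<le> 10 ^ 11 * (ln (real n) ^ 5 / \<epsilon> ^ 4)"
proof -
  define w where "w = ln (real n)"
  define u where "u = 3 * w / \<epsilon>"
  define b where "b = 1 / gap n \<epsilon>"
  have w: "2 / 3 \<le> w" using ln_ge_half[OF n] by (simp add: w_def)
  have "3 * w * 1 \<le> 3 * w * (1 / \<epsilon>)" using \<epsilon> w by (intro mult_left_mono) auto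
  then have u: "2 \<le> u" using w by (simp add: u_def)
  have b0: "0 < b" using gap_pos by (simp add: b_def)
  have "b = real (depth n) / \<epsilon>" by (simp add: b_def gap_def)
  also have "\<dots> \<le> u" using depth_le[OF n] \<epsilon> by (simp add: u_def w_def divide_right_mono)
  finally have b: "b \<le> u" .
  have b2: "b\<^sup>2 \<le> u\<^sup>2" using b b0 by (intro power_mono) auto
  have "2 / 3 * 2 \<le> w * u" using w u by (intro mult_mono) auto
  then have wu: "1 \<le> w * u" by simp
  have u1: "1 \<le> u\<^sup>2" using u by (simp add: one_le_power)
  have u12: "u * 1 \<le> u * u\<^sup>2" using u u1 by (intro mult_left_mono) auto
  have up: "0 \<le> u * u\<^sup>2" "0 \<le> w * u * u\<^sup>2" using u w by auto
  have blocks: "real (block_count n \<epsilon>) \<le> 801 * (w * u)"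
  proof -
    have "real (block_count n \<epsilon>) \<le> 800 * (w * b) + 1"
      unfolding block_count_def using w b0 by (simp add: w_def[symmetric] b_def)
    also have "w * b \<le> w * u" using b w by (intro mult_left_mono) auto
    finally show ?thesis using wu by linarith
  qed
  have "real (learning_samples n \<epsilon>) \<le> 400000 * (real (block_count n \<epsilon>) * b\<^sup>2) + 1"
  proof -
    have "400000 * real (block_count n \<epsilon>) / (gap n \<epsilon>)\<^sup>2 = 400000 * (real (block_count n \<epsilon>) * b\<^sup>2)"
      by (simp add: b_def power_divide)
    moreover have "0 \<le> 400000 * (real (block_count n \<epsilon>) * b\<^sup>2)" by simp
    ultimately show ?thesis unfolding learning_samples_def by linarith
  qed
  also have "real (block_count n \<epsilon>) * b\<^sup>2 \<le> 801 * (w * u) * u\<^sup>2"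
    using blocks b2 wu by (intro mult_mono) auto
  finally have N: "real (learning_samples n \<epsilon>) \<le> 320400000 * (w * u * u\<^sup>2) + 1" by simp
  have m: "real (rounds n \<epsilon>) \<le> 21 * u"
  proof -
    have "20 / gap n \<epsilon> = 20 * b" by (simp add: b_def)
    then have "real (rounds n \<epsilon>) \<le> 20 * b + 1" unfolding rounds_def using b0 by linarith
    with b u show ?thesis by linarith
  qed
  have M: "1 + real (cell_samples n \<epsilon>) \<le> 402 * u\<^sup>2"
  proof -
    have "400 / (gap n \<epsilon>)\<^sup>2 = 400 * b\<^sup>2" by (simp add: b_def power_divide)
    moreover have "0 \<le> b\<^sup>2" by simp
    ultimately have "real (cell_samples n \<epsilon>) \<le> 400 * b\<^sup>2 + 1"
      unfolding cell_samples_def by linarith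
    with b2 u1 show ?thesis by linarith
  qed
  have "real (rounds n \<epsilon>) * (1 + real (cell_samples n \<epsilon>)) \<le> (21 * u) * (402 * u\<^sup>2)"
    using m M u by (intro mult_mono) auto
  then have "real (query_bound n \<epsilon>) \<le> 320400000 * (w * u * u\<^sup>2) + 1 + 8442 * (u * u\<^sup>2)"
    using N unfolding query_bound_def of_nat_add of_nat_mult of_nat_1 by linarith
  moreover have "2 / 3 * (u * u\<^sup>2) \<le> w * (u * u\<^sup>2)" using w up by (intro mult_right_mono) auto
  ultimately have "real (query_bound n \<epsilon>) \<le> 400000000 * (w * u * u\<^sup>2)"
    using u u12 unfolding mult.assoc by linarith
  also have "w * u * u\<^sup>2 = 27 * (w ^ 4 / \<epsilon> ^ 3)"
    using \<epsilon> by (simp add: u_def power_divide power_mult_distrib power2_eq_square power3_eq_cube power4_eq_xxxx)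
  \<comment> \<open>Multiplying by \<open>3 / 2 * w / \<epsilon>\<close>, which is at least 1,
    relaxes the sharper bound to the required shape.\<close>
  also have "w ^ 4 / \<epsilon> ^ 3 \<le> 3 / 2 * (w ^ 5 / \<epsilon> ^ 4)"
  proof -
    have "w ^ 4 / \<epsilon> ^ 3 * 1 \<le> w ^ 4 / \<epsilon> ^ 3 * (3 / 2 * w / \<epsilon>)"
      using w \<epsilon> by (intro mult_left_mono) (auto simp: field_simps)
    also have "\<dots> = 3 / 2 * (w ^ 5 / \<epsilon> ^ 4)"
    proof -
      have "w ^ 5 = w ^ 4 * w" "\<epsilon> ^ 4 = \<epsilon> ^ 3 * \<epsilon>" by (simp_all add: power_numeral_reduce)
      then show ?thesis by simp
    qed
    finally show ?thesis by simp
  qed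
  finally have "real (query_bound n \<epsilon>) \<le> 16200000000 * (w ^ 5 / \<epsilon> ^ 4)" by simp
  also have "\<dots> \<le> 10 ^ 11 * (w ^ 5 / \<epsilon> ^ 4)"
    using w \<epsilon> by (intro mult_right_mono) auto
  finally show ?thesis by (simp add: w_def)
qed

section \<open>Error probabilities of the tester\<close>

lemma tester_run:
  assumes "D \<in> distributions n"
  shows "prob_outputs D (tester n \<epsilon>) v =
           measure_pmf.prob (tester_pmf n (depth n) (learning_samples n \<epsilon>) (cell_samples n \<epsilon>)
             (rounds n \<epsilon>) (real (rounds n \<epsilon>) * gap n \<epsilon> / 2) (learner n \<epsilon>) D) {v}"
    and "well_queried n D (query_bound n \<epsilon>) (tester n \<epsilon>)"
proof -
  have "prob_outputs D (tester n \<epsilon>) v = measure_pmf.prob (map_pmf fst (run D (tester n \<epsilon>))) {v}"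
    by (simp add: prob_outputs_def vimage_def)
  then show "prob_outputs D (tester n \<epsilon>) v =
           measure_pmf.prob (tester_pmf n (depth n) (learning_samples n \<epsilon>) (cell_samples n \<epsilon>)
             (rounds n \<epsilon>) (real (rounds n \<epsilon>) * gap n \<epsilon> / 2) (learner n \<epsilon>) D) {v}"
    by (simp only: tester_def tester_alg[OF assms])
  show "well_queried n D (query_bound n \<epsilon>) (tester n \<epsilon>)"
    unfolding tester_def query_bound_def by (rule tester_alg[OF assms])
qed

lemma prob_verdict_le:
  assumes D: "D \<in> distributions n" and "0 \<le> c"
    and le: "\<And>xs. xs \<notin> B \<Longrightarrow>
      measure_pmf.prob (replicate_pmf (rounds n \<epsilon>)
        (round_pmf n (depth n) (cell_samples n \<epsilon>) D (learner n \<epsilon> xs)))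
        {ys. verdict_of (real (rounds n \<epsilon>) * gap n \<epsilon> / 2) ys = v} \<le> c"
  shows "prob_outputs D (tester n \<epsilon>) v \<le>
           measure_pmf.prob (replicate_pmf (learning_samples n \<epsilon>) D) B + c"
proof -
  let ?\<theta> = "real (rounds n \<epsilon>) * gap n \<epsilon> / 2"
  let ?Q = "\<lambda>xs. replicate_pmf (rounds n \<epsilon>)
        (round_pmf n (depth n) (cell_samples n \<epsilon>) D (learner n \<epsilon> xs))"
  have "measure_pmf.prob (bind_pmf (?Q xs) (\<lambda>ys. return_pmf (verdict_of ?\<theta> ys))) {v} =
      measure_pmf.prob (?Q xs) {ys. verdict_of ?\<theta> ys = v}" for xs
    by (simp add: map_pmf_def[symmetric] vimage_def)
  with le \<open>0 \<le> c\<close> show ?thesis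
    unfolding tester_run(1)[OF D] tester_pmf_def
    by (intro prob_bind_pmf_le)
      (auto intro!: finite_set_replicate_pmf finite_set_distribution[OF D] finite_round_pmf[OF D] depth_pos)
qed

lemma expectation_round:
  assumes "D \<in> distributions n"
  shows "\<bar>measure_pmf.expectation (round_pmf n (depth n) (cell_samples n \<epsilon>) D H) (\<lambda>y. y)
           - (\<Sum>s<depth n. level_error D H s) / real (depth n)\<bar> \<le> gap n \<epsilon> / 20"
  using expectation_round_pmf[OF assms depth_pos cell_samples_ge(2) _ cell_samples_ge(1)] gap_pos
  by simp

text \<open>Soundness needs no success of the learner: every hypothesis is monotone, hence at
  distance at least \<epsilon> from \<open>D\<close>, and the level errors average at least \<beta>.
  So the set of bad sample lists is empty.\<close>

lemma prob_accept_le: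
  assumes D: "D \<in> distributions n" and far: "tv_dist_to n D (monotone_distributions n) \<ge> \<epsilon>"
  shows "prob_outputs D (tester n \<epsilon>) ACCEPT \<le> 1 / 3"
proof -
  have "measure_pmf.prob (replicate_pmf (rounds n \<epsilon>)
        (round_pmf n (depth n) (cell_samples n \<epsilon>) D (learner n \<epsilon> xs)))
        {ys. verdict_of (real (rounds n \<epsilon>) * gap n \<epsilon> / 2) ys = ACCEPT} \<le> 1 / 3" for xs
  proof -
    let ?H = "learner n \<epsilon> xs"
    have H: "?H \<in> monotone_distributions n"
      unfolding learner_def using n by (intro hypothesis) simp
    then have H': "?H \<in> distributions n" using monotone_distributions_subset by blast
    have "\<epsilon> \<le> tv_dist n D ?H" using far tv_dist_to_le[OF H, of n D] by linarith
    also have "\<dots> \<le> (\<Sum>s<depth n. level_error D ?H s)"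
      using n by (intro tv_dist_le_sum_level_error D H' less_two_power_depth) simp
    finally have "gap n \<epsilon> \<le> (\<Sum>s<depth n. level_error D ?H s) / real (depth n)"
      unfolding gap_def by (intro divide_right_mono) auto
    with expectation_round[OF D, of ?H]
    have "95 / 100 * gap n \<epsilon> \<le>
        measure_pmf.expectation (round_pmf n (depth n) (cell_samples n \<epsilon>) D ?H) (\<lambda>y. y)"
      by linarith
    from prob_sum_list_small_le[OF finite_round_pmf[OF D depth_pos]
        round_pmf_range[OF D cell_samples_ge(2)] this gap_pos rounds_ge(1)]
    show ?thesis by (simp add: verdict_of_def not_le)
  qed
  from prob_verdict_le[OF D _ this, of "{}"] show ?thesis by simp
qed

text \<open>If \<open>D\<close> fits its own samples, so does the hypothesis, and both are close.
  The two failure probabilities 1/10 and 18/100 add up to less than 1/3.\<close>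

lemma prob_reject_le:
  assumes D: "D \<in> monotone_distributions n"
  shows "prob_outputs D (tester n \<epsilon>) REJECT \<le> 1 / 3"
proof -
  let ?fits = "\<lambda>xs. fits (gap n \<epsilon> / 400) (block_count n \<epsilon>) (learning_samples n \<epsilon>) (gap n \<epsilon> / 200) xs"
  have D': "D \<in> distributions n" using D monotone_distributions_subset by blast
  have "measure_pmf.prob (replicate_pmf (rounds n \<epsilon>)
        (round_pmf n (depth n) (cell_samples n \<epsilon>) D (learner n \<epsilon> xs)))
        {ys. verdict_of (real (rounds n \<epsilon>) * gap n \<epsilon> / 2) ys = REJECT} \<le> 18 / 100"
    if "xs \<notin> {xs. \<not> ?fits xs D}" for xs
  proof -
    let ?H = "learner n \<epsilon> xs"
    have fits: "?fits xs D" using that by simp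
    have n1: "1 \<le> n" using n by simp
    have H: "?H \<in> monotone_distributions n" "?fits xs ?H"
      unfolding learner_def using hypothesis[OF n1] D fits by blast+
    then have H': "?H \<in> distributions n" using monotone_distributions_subset by blast
    have "tv_dist n D ?H \<le> gap n \<epsilon> / 200 + 2 * (gap n \<epsilon> / 400)"
      using gap_pos by (intro tv_dist_fitting_le[OF D H(1) fits H(2)] less_breakpoint_block_count) simp
    then have "level_error D ?H s \<le> 4 / 100 * gap n \<epsilon>" for s
      using level_error_le_tv_dist[OF D' H', of s] by linarith
    then have "(\<Sum>s<depth n. level_error D ?H s) \<le> (\<Sum>s<depth n. 4 / 100 * gap n \<epsilon>)"
      by (intro sum_mono)
    then have "(\<Sum>s<depth n. level_error D ?H s) / real (depth n) \<le> 4 / 100 * gap n \<epsilon>"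
      using depth_pos[of n] by (simp add: field_simps)
    with expectation_round[OF D', of ?H]
    have "measure_pmf.expectation (round_pmf n (depth n) (cell_samples n \<epsilon>) D ?H) (\<lambda>y. y)
        \<le> 9 / 100 * gap n \<epsilon>"
      by linarith
    from prob_sum_list_large_le[OF finite_round_pmf[OF D' depth_pos]
        round_pmf_range[OF D' cell_samples_ge(2)] this gap_pos rounds_ge(2)]
    show ?thesis by (simp add: verdict_of_def)
  qed
  from prob_verdict_le[where B = "{xs. \<not> ?fits xs D}", OF D' _ this]
  have "prob_outputs D (tester n \<epsilon>) REJECT \<le>
      measure_pmf.prob (replicate_pmf (learning_samples n \<epsilon>) D) {xs. \<not> ?fits xs D} + 18 / 100"
    by simp
  also have "measure_pmf.prob (replicate_pmf (learning_samples n \<epsilon>) D) {xs. \<not> ?fits xs D} \<le>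
      real (block_count n \<epsilon>) / (real (learning_samples n \<epsilon>) * (gap n \<epsilon> / 200)\<^sup>2)"
    using gap_pos learning_samples_ge(2)
    by (intro prob_not_fits_le finite_set_distribution[OF D']) auto
  also have "\<dots> \<le> 1 / 10"
    using learning_samples_ge gap_pos by (simp add: field_simps)
  finally show ?thesis by simp
qed

end

section \<open>From error bounds to the theorem\<close>

lemma prob_outputs_add: "prob_outputs D A ACCEPT + prob_outputs D A REJECT = 1"
proof -
  have "v = REJECT \<longleftrightarrow> v \<noteq> ACCEPT" for v by (cases v) auto
  then have "{r. fst r = REJECT} = space (measure_pmf (run D A)) - {r. fst r = ACCEPT}" by auto
  then have "prob_outputs D A REJECT = 1 - prob_outputs D A ACCEPT"
    unfolding prob_outputs_def by (simp only: measure_pmf.prob_compl sets_measure_pmf UNIV_I Pow_UNIV)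
  then show ?thesis by simp
qed

lemma monotonicity_tester_tester:
  assumes "2 \<le> n" "0 < \<epsilon>" "\<epsilon> \<le> 1"
  shows "monotonicity_tester n \<epsilon> (tester n \<epsilon>)" "makes_at_most n (tester n \<epsilon>) (query_bound n \<epsilon>)"
proof -
  note wq = tester_run(2)[OF assms]
  have "queries_admissible n (tester n \<epsilon>)"
    using wq unfolding queries_admissible_def well_queried_def case_prod_beta by blast
  moreover have "2 / 3 \<le> prob_outputs D (tester n \<epsilon>) ACCEPT"
    if "D \<in> monotone_distributions n" for D
    using prob_reject_le[OF assms that] prob_outputs_add[of D "tester n \<epsilon>"] by linarith
  moreover have "2 / 3 \<le> prob_outputs D (tester n \<epsilon>) REJECT"
    if "D \<in> distributions n" "tv_dist_to n D (monotone_distributions n) \<ge> \<epsilon>" for D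
    using prob_accept_le[OF assms that] prob_outputs_add[of D "tester n \<epsilon>"] by linarith
  ultimately show "monotonicity_tester n \<epsilon> (tester n \<epsilon>)"
    by (auto simp: monotonicity_tester_def)
  show "makes_at_most n (tester n \<epsilon>) (query_bound n \<epsilon>)"
    using wq unfolding makes_at_most_def well_queried_def case_prod_beta by blast
qed

text \<open>Since ln 1 = 0, the bound leaves no query for n = 1; there every distribution is
  monotone, so accepting is correct.\<close>

lemma monotonicity_tester_trivial:
  assumes "0 < \<epsilon>"
  shows "monotonicity_tester 1 \<epsilon> (Output ACCEPT)" "makes_at_most 1 (Output ACCEPT) 0"
proof -
  have "\<not> \<epsilon> \<le> tv_dist_to 1 D (monotone_distributions 1)" if "D \<in> distributions 1" for D
  proof -
    have "D \<in> monotone_distributions 1"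
      using that by (auto simp: monotone_distributions_def dest: le_antisym)
    from tv_dist_to_le[OF this, of 1 D] show ?thesis
      using assms by (simp add: tv_dist_def)
  qed
  then show "monotonicity_tester 1 \<epsilon> (Output ACCEPT)"
    by (auto simp: monotonicity_tester_def queries_admissible_def prob_outputs_def)
qed (simp add: makes_at_most_def)

theorem theorem4p2:
  "\<exists>(A :: nat \<Rightarrow> real \<Rightarrow> intcond_algorithm) (q :: nat \<Rightarrow> real \<Rightarrow> nat).
     soft_O_on ({1..} \<times> {0<..1})
       (\<lambda>(n, \<epsilon>). real (q n \<epsilon>)) (\<lambda>(n, \<epsilon>). (ln (real n)) ^ 5 / \<epsilon> ^ 4) \<and>
     (\<forall>n \<epsilon>. 1 \<le> n \<longrightarrow> 0 < \<epsilon> \<longrightarrow> \<epsilon> \<le> 1 \<longrightarrow>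
        makes_at_most n (A n \<epsilon>) (q n \<epsilon>) \<and> monotonicity_tester n \<epsilon> (A n \<epsilon>))"
proof (intro exI conjI allI impI)
  let ?A = "\<lambda>n \<epsilon>. if n = 1 then Output ACCEPT else tester n \<epsilon>"
  let ?q = "\<lambda>n \<epsilon>. if n = 1 then 0 else query_bound n \<epsilon>"
  \<comment> \<open>The logarithm gets exponent 0: the bound holds without a polylogarithmic factor,
    and for n = 1 both sides are 0.\<close>
  have "real (?q n \<epsilon>) \<le> 10 ^ 11 * (ln (real n) ^ 5 / \<epsilon> ^ 4) * log 2 (2 + ln (real n) ^ 5 / \<epsilon> ^ 4) ^ 0"
    if "1 \<le> n" "0 < \<epsilon>" "\<epsilon> \<le> 1" for n \<epsilon>
    using query_bound_le[of n \<epsilon>] that by (cases "n = 1") auto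
  then show "soft_O_on ({1..} \<times> {0<..1})
      (\<lambda>(n, \<epsilon>). real (?q n \<epsilon>)) (\<lambda>(n, \<epsilon>). (ln (real n)) ^ 5 / \<epsilon> ^ 4)"
    unfolding soft_O_on_def by (intro exI[of _ "10 ^ 11"] exI[of _ 0]) auto
  fix n :: nat and \<epsilon> :: real assume *: "1 \<le> n" "0 < \<epsilon>" "\<epsilon> \<le> 1"
  show "makes_at_most n (?A n \<epsilon>) (?q n \<epsilon>)"
    using * monotonicity_tester_tester(2)[of n \<epsilon>] monotonicity_tester_trivial(2)[of \<epsilon>] by (cases "n = 1") auto
  show "monotonicity_tester n \<epsilon> (?A n \<epsilon>)"
    using * monotonicity_tester_tester(1)[of n \<epsilon>] monotonicity_tester_trivial(1)[of \<epsilon>] by (cases "n = 1") auto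
qed

end
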